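(* Let $X$ be a proper, non-compact $\mathrm{CAT}(-1)$ space and let $\Gamma$ be a group of isometries of $X$ acting in a properly discontinuous and cocompact way on $X$. Then there exists an open set $\Omega\subset \partial_{\infty}^{\max}(X\times X)$ such that the diagonal action of $\Gamma$ on $X\times X\cup\Omega$ is properly discontinuous and cocompact.
   Context: A metric space is proper if its closed balls are compact. A $\mathrm{CAT}(-1)$ space is a geodesic metric space whose geodesic triangles are at least as thin as their comparison triangles in the hyperbolic plane $\mathbb{H}^2$. On $X\times X$ consider the maximum metric $d_{\max}((x,y),(x',y'))=\max\{d_X(x,x'),d_X(y,y')\}$. Let $C_*$ be the space of continuous functions $X\times X\to\mathbb{R}$ (with the topology of uniform convergence on compact sets) modulo additive constants, and embed $X\times X$ in $C_*$ by $\iota(x,y)=[d_{\max}((x,y),\cdot)]$. The compactification $\overline{X\times X}^{\max}$ is the closure of $\iota(X\times X)$ in $C_*$, and the ideal boundary is $\partial_\infty^{\max}(X\times X)=\overline{X\times X}^{\max}\setminus\iota(X\times X)$. We identify $X\times X$ with $\iota(X\times X)$, and $X\times X\cup\Omega$ carries the subspace topology from $\overline{X\times X}^{\max}$. The diagonal action of $\Gamma$ on $X\times X$ is $\gamma(x,y)=(\gamma x,\gamma y)$. It is by isometries of $d_{\max}$ and extends to an action by homeomorphisms on $\overline{X\times X}^{\max}$, namely $\gamma[h]=[h\circ\gamma^{-1}]$. That $\Gamma$ acts on $X\times X\cup\Omega$ includes that $\Omega$ is $\Gamma$-invariant. An action of $\Gamma$ on a space $Y$ is properly discontinuous if for every compact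 $K\subset Y$ the set $K\cap\gamma K$ is non-empty for only finitely many $\gamma\in\Gamma$; it is cocompact if there is a compact $K\subset Y$ with $Y=\Gamma K$. *)

theory Defs
  imports "HOL-Analysis.Analysis" "HOL-Algebra.Group"
begin

section \<open>The hyperbolic plane\<close>

typedef hyp_plane = "{z::complex. 0 < Im z}"
  morphisms uhp_coord Abs_hyp_plane
  by (rule exI[of _ \<i>]) simp

lemma Im_uhp_coord_pos [simp]: "0 < Im (uhp_coord x)"
  using uhp_coord by simp

lemma arsinh_real_le_iff: "arsinh x \<le> arsinh y \<longleftrightarrow> x \<le> (y::real)"
  by (cases x y rule: linorder_cases) (auto dest: arsinh_real_strict_mono intro: less_imp_le)

lemma uhp_cosh_aux:
  assumes "0 < Im z" "0 < Im w"
  shows "sqrt ((cmod (z - w) / (2 * sqrt (Im z * Im w)))\<^sup>2 + 1) =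
           cmod (z - cnj w) / (2 * sqrt (Im z * Im w))"
proof -
  have p: "0 < Im z * Im w" using assms by simp
  have "(cmod (z - cnj w))\<^sup>2 = (cmod (z - w))\<^sup>2 + 4 * (Im z * Im w)"
    unfolding cmod_power2 by (simp add: power2_eq_square algebra_simps)
  then have "(cmod (z - w) / (2 * sqrt (Im z * Im w)))\<^sup>2 + 1 =
      (cmod (z - cnj w) / (2 * sqrt (Im z * Im w)))\<^sup>2"
    using p assms[THEN less_imp_neq]
    by (simp add: power_divide power_mult_distrib add_divide_distrib)
  then show ?thesis using p by simp
qed

lemma uhp_ptolemy:
  assumes "0 < Im w"
  shows "2 * Im w * cmod (z - u) \<le>
    cmod (z - w) * cmod (w - cnj u) + cmod (z - cnj w) * cmod (w - u)"
proof -
  have "(z - u) * (w - cnj w) = (z - w) * (u - cnj w) + (w - u) * (z - cnj w)"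
    by (simp add: algebra_simps)
  then have "cmod (z - u) * cmod (w - cnj w) \<le>
      cmod (z - w) * cmod (u - cnj w) + cmod (w - u) * cmod (z - cnj w)"
    by (metis norm_mult norm_triangle_ineq)
  moreover have "cmod (w - cnj w) = 2 * Im w"
    using assms by (simp add: complex_diff_cnj norm_mult)
  moreover have "cmod (u - cnj w) = cmod (w - cnj u)"
    by (metis complex_cnj_cnj complex_cnj_diff complex_mod_cnj norm_minus_commute)
  ultimately show ?thesis by (simp add: mult.commute)
qed

instantiation hyp_plane :: metric_space
begin

text \<open>Equivalently, \<open>cosh (dist x y) = 1 + \<bar>z - w\<bar>\<^sup>2 / (2 * Im z * Im w)\<close>: this is the metric
  of constant curvature \<open>-1\<close> on the upper half-plane.\<close>

definition dist_hyp_plane :: "hyp_plane \<Rightarrow> hyp_plane \<Rightarrow> real" where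
  "dist_hyp_plane x y =
     2 * arsinh (cmod (uhp_coord x - uhp_coord y) /
                 (2 * sqrt (Im (uhp_coord x) * Im (uhp_coord y))))"

definition uniformity_hyp_plane :: "(hyp_plane \<times> hyp_plane) filter" where
  "uniformity_hyp_plane = (INF e\<in>{0<..}. principal {(x, y). dist x y < e})"

definition open_hyp_plane :: "hyp_plane set \<Rightarrow> bool" where
  "open_hyp_plane U = (\<forall>x\<in>U. \<forall>\<^sub>F (x', y) in uniformity. x' = x \<longrightarrow> y \<in> U)"

instance
proof
  fix x y z :: hyp_plane
  have "0 < Im (uhp_coord x) * Im (uhp_coord y)" by simp
  then have s: "sqrt (Im (uhp_coord x) * Im (uhp_coord y)) \<noteq> 0"
    by (metis less_irrefl real_sqrt_gt_zero)
  show "(dist x y = 0) = (x = y)"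
    using s by (auto simp: dist_hyp_plane_def uhp_coord_inject less_imp_neq)
  define X Y Z where "X = uhp_coord x" and "Y = uhp_coord y" and "Z = uhp_coord z"
  have pos: "0 < Im X" "0 < Im Y" "0 < Im Z" by (simp_all add: X_def Y_def Z_def)
  define a where "a = cmod (X - Z) / (2 * sqrt (Im X * Im Z))"
  define b where "b = cmod (Z - Y) / (2 * sqrt (Im Z * Im Y))"
  define c where "c = cmod (X - Y) / (2 * sqrt (Im X * Im Y))"
  have sq: "sqrt (Im X * Im Z) * sqrt (Im Z * Im Y) = Im Z * sqrt (Im X * Im Y)"
    using pos by (simp add: real_sqrt_mult)
  have "sinh (arsinh a + arsinh b) = a * sqrt (b\<^sup>2 + 1) + sqrt (a\<^sup>2 + 1) * b"
    by (simp add: sinh_add cosh_arsinh_real)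
  also have "\<dots> = (cmod (X - Z) * cmod (Z - cnj Y) + cmod (X - cnj Z) * cmod (Z - Y)) /
      (4 * (sqrt (Im X * Im Z) * sqrt (Im Z * Im Y)))"
    unfolding a_def b_def uhp_cosh_aux[OF pos(1,3)] uhp_cosh_aux[OF pos(3,2)]
    by (simp add: add_divide_distrib)
  also have "\<dots> \<ge> (2 * Im Z * cmod (X - Y)) / (4 * (sqrt (Im X * Im Z) * sqrt (Im Z * Im Y)))"
    using uhp_ptolemy[OF pos(3), of X Y] pos by (intro divide_right_mono) auto
  also have "(2 * Im Z * cmod (X - Y)) / (4 * (sqrt (Im X * Im Z) * sqrt (Im Z * Im Y))) = c"
    unfolding sq c_def using pos by simp
  finally have "c \<le> sinh (arsinh a + arsinh b)" .
  then have "arsinh c \<le> arsinh (sinh (arsinh a + arsinh b))"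
    by (simp only: arsinh_real_le_iff)
  then have "arsinh c \<le> arsinh a + arsinh b"
    by (simp only: arsinh_sinh_real)
  then show "dist x y \<le> dist x z + dist y z"
    by (simp add: dist_hyp_plane_def a_def b_def c_def X_def Y_def Z_def
        norm_minus_commute[of "uhp_coord y"] mult.commute)
qed (simp_all add: uniformity_hyp_plane_def open_hyp_plane_def)

end

section \<open>Geodesics and the \<open>CAT(-1)\<close> condition\<close>

definition geodesic_from_to :: "(real \<Rightarrow> 'a::metric_space) \<Rightarrow> 'a \<Rightarrow> 'a \<Rightarrow> bool" where
  "geodesic_from_to \<sigma> x y \<longleftrightarrow>
     \<sigma> 0 = x \<and> \<sigma> (dist x y) = y \<and>
     (\<forall>s\<in>{0..dist x y}. \<forall>t\<in>{0..dist x y}. dist (\<sigma> s) (\<sigma> t) = \<bar>s - t\<bar>)"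

definition geodesic_space :: "'a::metric_space itself \<Rightarrow> bool" where
  "geodesic_space _ \<longleftrightarrow> (\<forall>x y::'a. \<exists>\<sigma>. geodesic_from_to \<sigma> x y)"

definition geodesic_triangle ::
  "'a::metric_space \<Rightarrow> 'a \<Rightarrow> 'a \<Rightarrow> (real \<Rightarrow> 'a) \<Rightarrow> (real \<Rightarrow> 'a) \<Rightarrow> (real \<Rightarrow> 'a) \<Rightarrow> bool" where
  "geodesic_triangle x y z \<alpha> \<beta> \<gamma> \<longleftrightarrow>
     geodesic_from_to \<alpha> x y \<and> geodesic_from_to \<beta> y z \<and> geodesic_from_to \<gamma> z x"

text \<open>The comparison point of \<open>\<sigma> s\<close> on a side \<open>\<sigma>\<close> is \<open>\<sigma>' s\<close> on the corresponding side \<open>\<sigma>'\<close> of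
  the comparison triangle; each triple below consists of a side, its comparison side and their
  common length.\<close>

definition thin_triangles :: "'a::metric_space itself \<Rightarrow> bool" where
  "thin_triangles _ \<longleftrightarrow>
     (\<forall>(x::'a) y z \<alpha> \<beta> \<gamma> (x'::hyp_plane) y' z' \<alpha>' \<beta>' \<gamma>'.
        geodesic_triangle x y z \<alpha> \<beta> \<gamma> \<longrightarrow>
        geodesic_triangle x' y' z' \<alpha>' \<beta>' \<gamma>' \<longrightarrow>
        dist x' y' = dist x y \<longrightarrow> dist y' z' = dist y z \<longrightarrow> dist z' x' = dist z x \<longrightarrow>
        (\<forall>(\<sigma>, \<sigma>', l) \<in> {(\<alpha>, \<alpha>', dist x y), (\<beta>, \<beta>', dist y z), (\<gamma>, \<gamma>', dist z x)}.
         \<forall>(\<tau>, \<tau>', m) \<in> {(\<alpha>, \<alpha>', dist x y), (\<beta>, \<beta>', dist y z), (\<gamma>, \<gamma>', dist z x)}.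
         \<forall>s\<in>{0..l}. \<forall>t\<in>{0..m}. dist (\<sigma> s) (\<tau> t) \<le> dist (\<sigma>' s) (\<tau>' t)))"

definition CAT_minus_1 :: "'a::metric_space itself \<Rightarrow> bool" where
  "CAT_minus_1 T \<longleftrightarrow> geodesic_space T \<and> thin_triangles T"

definition proper_space :: "'a::metric_space itself \<Rightarrow> bool" where
  "proper_space _ \<longleftrightarrow> (\<forall>(x::'a) r. compact (cball x r))"

section \<open>Isometries and group actions\<close>

definition isometry_group :: "('a::metric_space \<Rightarrow> 'a) monoid" where
  "isometry_group =
     \<lparr>carrier = {g. surj g \<and> (\<forall>x y. dist (g x) (g y) = dist x y)}, mult = (\<circ>), one = id\<rparr>"

lemma isometry_inj: "(\<And>x y. dist (g x) (g y) = dist x y) \<Longrightarrow> inj (g :: 'a::metric_space \<Rightarrow> 'a)"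
  by (metis dist_eq_0_iff injI)

lemma group_isometry_group: "group (isometry_group :: ('a::metric_space \<Rightarrow> 'a) monoid)"
proof (rule groupI)
  fix g :: "'a \<Rightarrow> 'a" assume "g \<in> carrier isometry_group"
  then have g: "surj g" "\<And>x y. dist (g x) (g y) = dist x y"
    by (auto simp: isometry_group_def)
  have "bij g" using g isometry_inj[of g] by (simp add: bij_def)
  then have "inv_into UNIV g \<in> carrier isometry_group"
    unfolding isometry_group_def using g
    by (auto simp: bij_is_inj inj_imp_surj_inv) (metis surj_f_inv_f)
  moreover have "inv_into UNIV g \<circ> g = id"
    using \<open>bij g\<close> by (simp add: bij_is_inj)
  ultimately show "\<exists>h\<in>carrier isometry_group. h \<otimes>\<^bsub>isometry_group\<^esub> g = \<one>\<^bsub>isometry_group\<^esub>"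
    by (auto simp: isometry_group_def)
next
  fix g h :: "'a \<Rightarrow> 'a" assume "g \<in> carrier isometry_group" "h \<in> carrier isometry_group"
  then show "g \<otimes>\<^bsub>isometry_group\<^esub> h \<in> carrier isometry_group"
    using comp_surj[of h g] by (simp add: isometry_group_def)
qed (simp_all add: isometry_group_def comp_assoc)

definition properly_discontinuous ::
  "'g set \<Rightarrow> ('g \<Rightarrow> 'y \<Rightarrow> 'y) \<Rightarrow> 'y topology \<Rightarrow> bool" where
  "properly_discontinuous G act Y \<longleftrightarrow>
     (\<forall>K. compactin Y K \<longrightarrow> finite {g \<in> G. K \<inter> act g ` K \<noteq> {}})"

definition cocompact :: "'g set \<Rightarrow> ('g \<Rightarrow> 'y \<Rightarrow> 'y) \<Rightarrow> 'y topology \<Rightarrow> bool" where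
  "cocompact G act Y \<longleftrightarrow> (\<exists>K. compactin Y K \<and> topspace Y = (\<Union>g\<in>G. act g ` K))"

section \<open>Continuous functions modulo constants\<close>

definition compact_convergence_topology :: "('b::topological_space \<Rightarrow> real) topology" where
  "compact_convergence_topology = topology (\<lambda>U.
     U \<subseteq> {f. continuous_on UNIV f} \<and>
     (\<forall>f\<in>U. \<exists>K e. compact K \<and> 0 < e \<and>
        {g. continuous_on UNIV g \<and> (\<forall>x\<in>K. \<bar>g x - f x\<bar> < e)} \<subseteq> U))"

lemma openin_compact_convergence_topology:
  "openin compact_convergence_topology U \<longleftrightarrow>
     U \<subseteq> {f. continuous_on UNIV f} \<and>
     (\<forall>f\<in>U. \<exists>K e. compact K \<and> 0 < e \<and>
        {g. continuous_on UNIV g \<and> (\<forall>x\<in>K. \<bar>g x - f x\<bar> < e)} \<subseteq> U)"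
    (is "_ \<longleftrightarrow> ?P U")
proof -
  have "?P (S \<inter> T)" if S: "?P S" and T: "?P T" for S T
  proof (intro conjI ballI)
    fix f assume f: "f \<in> S \<inter> T"
    obtain K e where K: "compact K" "0 < e"
      "{g. continuous_on UNIV g \<and> (\<forall>x\<in>K. \<bar>g x - f x\<bar> < e)} \<subseteq> S"
      using S f by (meson IntD1)
    obtain L d where L: "compact L" "0 < d"
      "{g. continuous_on UNIV g \<and> (\<forall>x\<in>L. \<bar>g x - f x\<bar> < d)} \<subseteq> T"
      using T f by (meson IntD2)
    have "{g. continuous_on UNIV g \<and> (\<forall>x\<in>K \<union> L. \<bar>g x - f x\<bar> < min e d)} \<subseteq> S \<inter> T"
      using K(3) L(3) by auto
    then show "\<exists>K e. compact K \<and> 0 < e \<and>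
        {g. continuous_on UNIV g \<and> (\<forall>x\<in>K. \<bar>g x - f x\<bar> < e)} \<subseteq> S \<inter> T"
      using K(1,2) L(1,2) by (intro exI[of _ "K \<union> L"] exI[of _ "min e d"]) (simp add: compact_Un)
  qed (use S in auto)
  moreover have "?P (\<Union>\<K>)" if "\<forall>S\<in>\<K>. ?P S" for \<K>
  proof (intro conjI ballI)
    fix f assume "f \<in> \<Union>\<K>"
    then obtain S where S: "S \<in> \<K>" "f \<in> S" by blast
    have "?P S" using \<open>\<forall>S\<in>\<K>. ?P S\<close> S(1) by (rule bspec)
    then obtain K e where "compact K" "0 < e"
      "{g. continuous_on UNIV g \<and> (\<forall>x\<in>K. \<bar>g x - f x\<bar> < e)} \<subseteq> S"
      using S(2) by meson
    then show "\<exists>K e. compact K \<and> 0 < e \<and>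
        {g. continuous_on UNIV g \<and> (\<forall>x\<in>K. \<bar>g x - f x\<bar> < e)} \<subseteq> \<Union>\<K>"
      using S(1) by (meson Union_upper subset_trans)
  qed (use that in blast)
  ultimately have "istopology ?P"
    unfolding istopology_def by blast
  then show ?thesis
    by (simp add: compact_convergence_topology_def topology_inverse')
qed

lemma topspace_compact_convergence_topology [simp]:
  "topspace compact_convergence_topology = {f. continuous_on UNIV f}"
proof
  show "topspace compact_convergence_topology \<subseteq> {f. continuous_on UNIV f}"
    by (metis openin_compact_convergence_topology openin_topspace)
  have "openin compact_convergence_topology {f::'a \<Rightarrow> real. continuous_on UNIV f}"
    unfolding openin_compact_convergence_topology
    by (auto intro!: exI[of _ "{}"] exI[of _ "1::real"])
  then show "{f::'a \<Rightarrow> real. continuous_on UNIV f} \<subseteq> topspace compact_convergence_topology"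
    by (rule openin_subset)
qed

definition quotient_topology :: "'a topology \<Rightarrow> ('a \<Rightarrow> 'b) \<Rightarrow> 'b topology" where
  "quotient_topology X q = topology (\<lambda>U.
     U \<subseteq> q ` topspace X \<and> openin X {x \<in> topspace X. q x \<in> U})"

lemma openin_quotient_topology:
  "openin (quotient_topology X q) U \<longleftrightarrow>
     U \<subseteq> q ` topspace X \<and> openin X {x \<in> topspace X. q x \<in> U}" (is "_ \<longleftrightarrow> ?P U")
proof -
  have "?P (S \<inter> T)" if S: "?P S" and T: "?P T" for S T
  proof -
    have "{x \<in> topspace X. q x \<in> S \<inter> T} =
        {x \<in> topspace X. q x \<in> S} \<inter> {x \<in> topspace X. q x \<in> T}" by auto
    then show ?thesis using S T by auto
  qed
  moreover have "?P (\<Union>\<K>)" if "\<forall>S\<in>\<K>. ?P S" for \<K>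
  proof -
    have "{x \<in> topspace X. q x \<in> \<Union>\<K>} = (\<Union>S\<in>\<K>. {x \<in> topspace X. q x \<in> S})" by auto
    then show ?thesis using that by auto
  qed
  ultimately have "istopology ?P"
    unfolding istopology_def by blast
  then show ?thesis
    by (simp add: quotient_topology_def topology_inverse')
qed

lemma topspace_quotient_topology [simp]: "topspace (quotient_topology X q) = q ` topspace X"
proof
  show "topspace (quotient_topology X q) \<subseteq> q ` topspace X"
    by (metis openin_quotient_topology openin_topspace)
  have "{x \<in> topspace X. q x \<in> q ` topspace X} = topspace X" by auto
  then show "q ` topspace X \<subseteq> topspace (quotient_topology X q)"
    by (intro openin_subset) (simp add: openin_quotient_topology)
qed

lemma quotient_map_quotient_topology: "quotient_map X (quotient_topology X q) q"
  by (auto simp: quotient_map_def openin_quotient_topology)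

definition const_rel :: "(('b::topological_space \<Rightarrow> real) \<times> ('b \<Rightarrow> real)) set" where
  "const_rel = {(f, g). continuous_on UNIV f \<and> continuous_on UNIV g \<and> (\<exists>c. \<forall>x. g x = f x + c)}"

lemma equiv_const_rel: "equiv {f. continuous_on UNIV f} const_rel"
proof (rule equivI)
  show "refl_on {f::'a \<Rightarrow> real. continuous_on UNIV f} const_rel"
    by (auto simp: refl_on_def const_rel_def intro: exI[of _ 0])
  show "sym (const_rel :: (('a \<Rightarrow> real) \<times> _) set)"
  proof (rule symI)
    fix f g :: "'a \<Rightarrow> real" assume "(f, g) \<in> const_rel"
    then obtain c where "continuous_on UNIV f" "continuous_on UNIV g" "\<forall>x. g x = f x + c"
      by (auto simp: const_rel_def)
    then show "(g, f) \<in> const_rel" by (auto simp: const_rel_def intro!: exI[of _ "-c"])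
  qed
  show "trans (const_rel :: (('a \<Rightarrow> real) \<times> _) set)"
  proof (rule transI)
    fix f g h :: "'a \<Rightarrow> real" assume "(f, g) \<in> const_rel" "(g, h) \<in> const_rel"
    then obtain c d where "continuous_on UNIV f" "continuous_on UNIV h"
      "\<forall>x. g x = f x + c" "\<forall>x. h x = g x + d"
      by (auto simp: const_rel_def)
    then show "(f, h) \<in> const_rel" by (auto simp: const_rel_def intro!: exI[of _ "c + d"])
  qed
qed (auto simp: const_rel_def)

definition mod_const :: "('b::topological_space \<Rightarrow> real) \<Rightarrow> ('b \<Rightarrow> real) set" where
  "mod_const f = const_rel `` {f}"

definition C_star :: "(('b::topological_space \<Rightarrow> real) set) topology" where
  "C_star = quotient_topology compact_convergence_topology mod_const"

lemma topspace_C_star: "topspace C_star = {f. continuous_on UNIV f} // const_rel"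
  by (auto simp: C_star_def quotient_def mod_const_def)

section \<open>The compactification of \<open>X \<times> X\<close> for the maximum metric\<close>

text \<open>The library metric on \<open>'a \<times> 'a\<close> is the Euclidean product metric; only its topology, which is
  also that of \<open>dmax\<close>, is used.\<close>

definition dmax :: "'a::metric_space \<times> 'a \<Rightarrow> 'a \<times> 'a \<Rightarrow> real" where
  "dmax p q = max (dist (fst p) (fst q)) (dist (snd p) (snd q))"

definition iota :: "'a::metric_space \<times> 'a \<Rightarrow> ('a \<times> 'a \<Rightarrow> real) set" where
  "iota p = mod_const (dmax p)"

definition max_compactification :: "(('a::metric_space \<times> 'a \<Rightarrow> real) set) topology" where
  "max_compactification = subtopology C_star (C_star closure_of range iota)"

definition max_boundary :: "('a::metric_space \<times> 'a \<Rightarrow> real) set set" where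
  "max_boundary = topspace max_compactification - range iota"

text \<open>The action \<open>\<gamma>[h] = [h \<circ> \<gamma>\<^sup>-\<^sup>1]\<close>, where \<open>\<gamma>\<close> acts diagonally. It is defined on a class as the
  image of its members; \<open>diag_act_mod_const\<close> gives the description by representatives.\<close>

definition diag_act ::
  "('a::metric_space \<Rightarrow> 'a) \<Rightarrow> ('a \<times> 'a \<Rightarrow> real) set \<Rightarrow> ('a \<times> 'a \<Rightarrow> real) set" where
  "diag_act g A = (\<lambda>h. h \<circ> inv_into UNIV (map_prod g g)) ` A"

lemma continuous_on_dmax: "continuous_on UNIV (dmax p)"
  unfolding dmax_def by (intro continuous_intros)

lemma isometry_map_prod:
  assumes "g \<in> carrier isometry_group"
  shows "bij g" "bij (map_prod g g)" "inv_into UNIV (map_prod g g) = map_prod (inv_into UNIV g) (inv_into UNIV g)"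
    "dist (inv_into UNIV g x) y = dist x (g y)" "continuous_on UNIV g" "continuous_on UNIV (inv_into UNIV g)"
proof -
  have g: "surj g" "\<And>x y. dist (g x) (g y) = dist x y"
    using assms by (auto simp: isometry_group_def)
  show b: "bij g" using g isometry_inj[of g] by (simp add: bij_def)
  then show bb: "bij (map_prod g g)"
    by (auto simp: bij_def prod.inj_map map_prod_surj)
  show "inv_into UNIV (map_prod g g) = map_prod (inv_into UNIV g) (inv_into UNIV g)"
    by (rule inv_equality) (use b in \<open>auto simp: bij_is_inj bij_is_surj surj_f_inv_f\<close>)
  show "dist (inv_into UNIV g x) y = dist x (g y)"
    by (metis g surj_f_inv_f)
  have h: "dist (inv_into UNIV g x) (inv_into UNIV g y) = dist x y" for x y
    by (metis g surj_f_inv_f)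
  show "continuous_on UNIV g" "continuous_on UNIV (inv_into UNIV g)"
    unfolding continuous_on_iff using g(2) h by metis+
qed

lemma diag_act_mod_const:
  assumes g: "g \<in> carrier isometry_group" and f: "continuous_on UNIV f"
  shows "diag_act g (mod_const f) = mod_const (f \<circ> inv_into UNIV (map_prod g g))"
proof -
  let ?G = "map_prod g g" and ?H = "inv_into UNIV (map_prod g g)"
  note m = isometry_map_prod[OF g]
  have cH: "continuous_on UNIV ?H"
    unfolding m(3) unfolding map_prod_def case_prod_beta
    by (auto intro!: continuous_intros continuous_on_compose2[OF m(6)])
  have cG: "continuous_on UNIV ?G"
    unfolding map_prod_def case_prod_beta
    by (auto intro!: continuous_intros continuous_on_compose2[OF m(5)])
  have HG: "?H (?G p) = p" "?G (?H p) = p" for p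
    using m(2) by (simp_all add: bij_is_inj bij_is_surj surj_f_inv_f)
  show ?thesis
  proof
    show "diag_act g (mod_const f) \<subseteq> mod_const (f \<circ> ?H)"
    proof
      fix k assume "k \<in> diag_act g (mod_const f)"
      then obtain h c where h: "k = h \<circ> ?H" "continuous_on UNIV h" "\<And>p. h p = f p + c"
        unfolding diag_act_def mod_const_def const_rel_def by blast
      have "continuous_on UNIV (f \<circ> ?H)" "continuous_on UNIV k"
        unfolding h(1) using f h(2) cH by (metis continuous_on_compose continuous_on_subset top_greatest)+
      then show "k \<in> mod_const (f \<circ> ?H)"
        unfolding mod_const_def const_rel_def using h(1,3) by auto
    qed
    show "mod_const (f \<circ> ?H) \<subseteq> diag_act g (mod_const f)"
    proof
      fix h assume "h \<in> mod_const (f \<circ> ?H)"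
      then obtain c where h: "continuous_on UNIV h" "\<And>p. h p = f (?H p) + c"
        unfolding mod_const_def const_rel_def by (auto simp only: Image_singleton_iff case_prod_conv mem_Collect_eq comp_apply)
      have "continuous_on UNIV (h \<circ> ?G)"
        using h(1) cG by (metis continuous_on_compose continuous_on_subset top_greatest)
      moreover have "(h \<circ> ?G) p = f p + c" for p using h(2)[of "?G p"] HG(1) by simp
      ultimately have "h \<circ> ?G \<in> mod_const f"
        using f unfolding mod_const_def const_rel_def by blast
      moreover have "h = (h \<circ> ?G) \<circ> ?H" using HG by (simp add: fun_eq_iff)
      ultimately show "h \<in> diag_act g (mod_const f)"
        unfolding diag_act_def by blast
    qed
  qed
qed

lemma diag_act_iota:
  assumes "g \<in> carrier isometry_group"
  shows "diag_act g (iota (x, y)) = iota (g x, g y)"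
proof -
  note m = isometry_map_prod[OF assms]
  have "dmax (x, y) \<circ> inv_into UNIV (map_prod g g) = dmax (g x, g y)"
    unfolding m(3) by (auto simp: dmax_def fun_eq_iff dist_commute[of x] dist_commute[of y] m(4))
      (simp_all add: dist_commute)
  then show ?thesis
    by (simp add: iota_def diag_act_mod_const[OF assms continuous_on_dmax])
qed

end

theory Submission
  imports Defs
begin

text \<open>Restrict a function \<open>h\<close> on \<open>X \<times> X\<close> to the diagonal and call \<open>m\<close> a centre of \<open>h\<close> if
  \<open>h (z, z) \<ge> h (m, m) + ln (cosh (dist m z))\<close> for all \<open>z\<close>. A centre is unique, it depends only on
  the class of \<open>h\<close> modulo constants, and isometries carry centres to centres. The set \<open>\<Omega>\<close> consists
  of the boundary classes that have a centre. In terms of Busemann functions these are the classes of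
  \<open>max (\<beta>\<^sub>\<xi> x) (\<beta>\<^sub>\<eta> y + c)\<close> for distinct points \<open>\<xi>\<close>, \<open>\<eta>\<close> at infinity, the centre lying on the
  geodesic from \<open>\<xi>\<close> to \<open>\<eta>\<close>.

  The \<open>CAT(-1)\<close> condition says that the midpoint of \<open>x\<close> and \<open>y\<close> is a centre of \<open>dmax (x, y)\<close>: in
  the hyperbolic plane the midpoint \<open>m\<close> of a segment of length \<open>2 r\<close> from \<open>x\<close> to \<open>y\<close> satisfies
  \<open>2 cosh r cosh (dist z m) = cosh (dist z x) + cosh (dist z y)\<close>, so that in \<open>X\<close>, with \<open>M\<close> the larger of
  the two distances from \<open>z\<close>, \<open>cosh r cosh (dist z m) \<le> cosh M\<close>, whence
  \<open>M \<ge> r + ln (cosh (dist m z))\<close>. The point is that this lower bound on the growth away from the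
  centre does not depend on \<open>r\<close>, so it survives as \<open>x\<close> and \<open>y\<close> tend to infinity
  (\<open>is_centre_dmax\<close>).

  Hence \<open>Y = X \<times> X \<union> \<Omega>\<close> carries an equivariant map to \<open>X\<close>, sending a class to its centre, and the
  theorem follows from two properties of this map. It is locally bounded, even near each point of \<open>Y\<close>
  in the whole compactification (\<open>centre_locally_bounded\<close>): if \<open>h\<close> has centre \<open>m\<close>, then
  \<open>h (z, z) > h (m, m)\<close> on the compact shell \<open>1 \<le> dist m z \<le> 2\<close>, and this persists nearby; for a
  nearby \<open>dmax p\<close>, quasi-convexity along geodesics forbids a centre beyond the shell. Having a
  centre in a given compact set is a closed condition, so the conclusion passes to the closure.
  Thus \<open>Y\<close> is open, and a compact subset of \<open>Y\<close> has its centres in a compact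
  subset of \<open>X\<close>, which gives proper discontinuity. Conversely the classes in the compactification with
  centre in a compact \<open>K\<close> form a compact set, because the compactification is compact
  (\<open>compactin_closure_range_iota\<close>, a Tychonoff argument); its translates cover \<open>Y\<close> when those of \<open>K\<close>
  cover \<open>X\<close>.\<close>

section \<open>The hyperboloid model and comparison triangles\<close>

text \<open>Points of the hyperboloid are written as symmetric matrices of determinant \<open>1\<close>, with \<open>(a, b, c)\<close>
  standing for the matrix with rows \<open>(a, b)\<close> and \<open>(b, c)\<close>; the form is the polarization of the
  determinant.\<close>
definition lorentz :: "real \<times> real \<times> real \<Rightarrow> real \<times> real \<times> real \<Rightarrow> real" where
  "lorentz v w = (fst v * snd (snd w) + snd (snd v) * fst w) / 2 - fst (snd v) * fst (snd w)"

lemma lorentz_add_left: "lorentz (u + v) w = lorentz u w + lorentz v w"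
  and lorentz_add_right: "lorentz w (u + v) = lorentz w u + lorentz w v"
  and lorentz_diff_left: "lorentz (u - v) w = lorentz u w - lorentz v w"
  and lorentz_diff_right: "lorentz w (u - v) = lorentz w u - lorentz w v"
  and lorentz_scale_left: "lorentz (c *\<^sub>R v) w = c * lorentz v w"
  and lorentz_scale_right: "lorentz w (c *\<^sub>R v) = c * lorentz w v"
  by (simp_all add: lorentz_def algebra_simps add_divide_distrib diff_divide_distrib)

lemmas lorentz_bilinear =
  lorentz_add_left lorentz_add_right lorentz_diff_left lorentz_diff_right
  lorentz_scale_left lorentz_scale_right

lemma lorentz_commute: "lorentz v w = lorentz w v"
  by (simp add: lorentz_def algebra_simps)

text \<open>This is the identification of the half-plane with the hyperboloid. It turns geodesics and midpoints
  into linear algebra, which makes existence statements in \<open>hyp_plane\<close> easy.\<close>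
definition hcoord :: "hyp_plane \<Rightarrow> real \<times> real \<times> real" where
  "hcoord p = ((cmod (uhp_coord p))\<^sup>2 / Im (uhp_coord p),
               Re (uhp_coord p) / Im (uhp_coord p), 1 / Im (uhp_coord p))"

lemma hcoord_pos: "0 < snd (snd (hcoord p))"
  by (simp add: hcoord_def)

lemma cosh_dist_hyp_plane: "cosh (dist p q) = lorentz (hcoord p) (hcoord q)"
proof -
  define z w where "z = uhp_coord p" and "w = uhp_coord q"
  have pos: "0 < Im z" "0 < Im w" by (simp_all add: z_def w_def)
  define u where "u = cmod (z - w) / (2 * sqrt (Im z * Im w))"
  have "cosh (dist p q) = 1 + 2 * u\<^sup>2"
    unfolding dist_hyp_plane_def z_def[symmetric] w_def[symmetric] u_def[symmetric]
    by (simp only: cosh_double cosh_square_eq sinh_arsinh_real)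
  also have "u\<^sup>2 = (cmod (z - w))\<^sup>2 / (4 * (Im z * Im w))"
    using pos by (simp add: u_def power_divide power_mult_distrib)
  also have "1 + 2 * \<dots> = lorentz (hcoord p) (hcoord q)"
    using pos unfolding lorentz_def hcoord_def z_def[symmetric] w_def[symmetric] cmod_power2
    by (simp add: field_simps power2_eq_square)
  finally show ?thesis .
qed

lemma lorentz_hcoord_self: "lorentz (hcoord p) (hcoord p) = 1"
  using cosh_dist_hyp_plane[of p p] by simp

lemma hcoord_surj:
  assumes "lorentz v v = 1" "0 < snd (snd v)"
  shows "\<exists>p. hcoord p = v"
proof -
  obtain a b c where v: "v = (a, b, c)" by (metis prod.collapse)
  have c: "0 < c" and abc: "a * c - b * b = 1"
    using assms by (simp_all add: v lorentz_def)
  have "uhp_coord (Abs_hyp_plane (Complex (b / c) (1 / c))) = Complex (b / c) (1 / c)"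
    using c by (intro Abs_hyp_plane_inverse) simp
  moreover have "(b\<^sup>2 + 1) / c = a"
    using abc c by (simp add: field_simps power2_eq_square)
  ultimately have "hcoord (Abs_hyp_plane (Complex (b / c) (1 / c))) = v"
    using c by (simp add: hcoord_def v cmod_power2 power_divide add_divide_distrib)
      (simp add: power2_eq_square field_simps)
  then show ?thesis by blast
qed

lemma dist_eqI_cosh:
  assumes "lorentz (hcoord p) (hcoord q) = cosh t"
  shows "dist p q = \<bar>t\<bar>"
proof -
  have "cosh (dist p q) = cosh \<bar>t\<bar>"
    using assms by (simp add: cosh_dist_hyp_plane)
  then show ?thesis
    by (metis abs_ge_zero antisym cosh_real_nonneg_le_iff order_refl zero_le_dist)
qed

text \<open>In the hyperboloid model the geodesic from \<open>P\<close> to \<open>Q\<close> at distance \<open>d\<close> is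
  \<open>(sinh (d - t) P + sinh t Q) / sinh d\<close>. Its midpoint is a multiple of \<open>P + Q\<close>, so pairing it with
  a third point gives the exact median formula.\<close>
lemma hyp_plane_geodesic:
  fixes x y :: hyp_plane
  obtains \<sigma> where "geodesic_from_to \<sigma> x y"
    "\<And>p. 2 * cosh (dist x y / 2) * cosh (dist p (\<sigma> (dist x y / 2))) =
          cosh (dist p x) + cosh (dist p y)"
proof (cases "x = y")
  case True
  then show ?thesis
    using that[of "\<lambda>_. x"] by (simp add: geodesic_from_to_def)
next
  case False
  define d where "d = dist x y"
  have d: "0 < d" and sd: "0 < sinh d" using False by (simp_all add: d_def)
  define P Q where "P = hcoord x" and "Q = hcoord y"
  \<comment> \<open>\<open>W\<close> is the unit tangent vector at \<open>P\<close> pointing to \<open>Q\<close>.\<close>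
  define W where "W = (1 / sinh d) *\<^sub>R (Q - cosh d *\<^sub>R P)"
  define v where "v t = cosh t *\<^sub>R P + sinh t *\<^sub>R W" for t
  have PP: "lorentz P P = 1" and QQ: "lorentz Q Q = 1" and PQ: "lorentz P Q = cosh d"
    by (simp_all add: P_def Q_def lorentz_hcoord_self d_def cosh_dist_hyp_plane)
  have PW: "lorentz P W = 0"
    by (simp add: W_def lorentz_bilinear PP PQ)
  have "lorentz W W = (1 - (cosh d)\<^sup>2) / (sinh d)\<^sup>2"
    using PQ by (simp add: W_def lorentz_bilinear PP QQ lorentz_commute[of Q P]
        power2_eq_square algebra_simps diff_divide_distrib)
  also have "\<dots> = - 1" using sd by (simp add: cosh_square_eq)
  finally have WW: "lorentz W W = - 1" .
  have vv: "lorentz (v s) (v t) = cosh (s - t)" for s t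
    by (simp add: v_def lorentz_bilinear PP PW WW lorentz_commute[of W P] cosh_diff)
  \<comment> \<open>The combination of \<open>P\<close> and \<open>Q\<close> shows that \<open>v t\<close> stays on the sheet with positive last coordinate.\<close>
  have v_eq: "v t = (1 / sinh d) *\<^sub>R (sinh (d - t) *\<^sub>R P + sinh t *\<^sub>R Q)" for t
    using sd by (simp add: v_def W_def sinh_diff prod_eq_iff field_simps)
  have v_pos: "0 < snd (snd (v t))" if "t \<in> {0..d}" for t
  proof -
    have "0 < sinh (d - t) * snd (snd P) + sinh t * snd (snd Q)"
    proof (cases "t = d")
      case True
      then show ?thesis using sd hcoord_pos[of y] by (simp add: Q_def)
    next
      case False
      then show ?thesis using that hcoord_pos[of x] hcoord_pos[of y]
        by (intro add_pos_nonneg) (simp_all add: P_def Q_def)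
    qed
    then show ?thesis using sd by (simp add: v_eq)
  qed
  have "\<exists>p. t \<in> {0..d} \<longrightarrow> hcoord p = v t" for t
    using hcoord_surj[of "v t"] vv[of t t] v_pos[of t] by auto
  then obtain \<sigma> where \<sigma>: "\<And>t. t \<in> {0..d} \<Longrightarrow> hcoord (\<sigma> t) = v t" by metis
  have "dist (\<sigma> 0) x = \<bar>0\<bar>"
    by (rule dist_eqI_cosh) (use \<sigma>[of 0] d PP in \<open>simp add: v_def P_def\<close>)
  moreover have "dist (\<sigma> d) y = \<bar>0\<bar>"
    by (rule dist_eqI_cosh) (use \<sigma>[of d] d sd QQ in \<open>simp add: v_eq Q_def\<close>)
  moreover have "dist (\<sigma> s) (\<sigma> t) = \<bar>s - t\<bar>" if "s \<in> {0..d}" "t \<in> {0..d}" for s t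
    by (rule dist_eqI_cosh) (use that in \<open>simp only: \<sigma> vv\<close>)
  ultimately have "geodesic_from_to \<sigma> x y"
    by (simp add: geodesic_from_to_def d_def)
  moreover have "2 * cosh (d / 2) * cosh (dist p (\<sigma> (d / 2))) = cosh (dist p x) + cosh (dist p y)" for p
  proof -
    have sh: "sinh d = 2 * sinh (d / 2) * cosh (d / 2)"
      using sinh_double[of "d / 2"] by simp
    have "sinh (d / 2) \<noteq> 0" using d by simp
    moreover have "cosh (d / 2) \<noteq> 0" by (metis cosh_real_pos less_irrefl)
    ultimately have "2 * cosh (d / 2) * (sinh (d / 2) / sinh d) = 1"
      by (simp add: sh)
    moreover have "cosh (dist p (\<sigma> (d / 2))) =
        (sinh (d / 2) / sinh d) * (lorentz (hcoord p) P + lorentz (hcoord p) Q)"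
      using \<sigma>[of "d / 2"] d
      by (simp add: cosh_dist_hyp_plane v_eq lorentz_bilinear add_divide_distrib distrib_left)
    ultimately show ?thesis
      by (simp add: cosh_dist_hyp_plane P_def Q_def mult.assoc[symmetric])
  qed
  ultimately show ?thesis using that by (simp add: d_def)
qed

text \<open>Two vertices are placed at \<open>\<i>\<close> and \<open>\<i> e\<^sup>c\<close>. The two required distances to the third vertex
  are linear conditions on it, which determine its outer coordinates; the determinant condition
  can then be solved for the middle one exactly when the triangle inequalities hold.\<close>
lemma comparison_triangle_exists:
  fixes a b c :: real
  assumes "0 \<le> a" "0 \<le> b" "0 \<le> c" "a \<le> b + c" "b \<le> a + c" "c \<le> a + b"
  obtains x y z :: hyp_plane where "dist x y = c" "dist y z = a" "dist z x = b"
proof -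
  \<comment> \<open>The third vertex is \<open>(cosh b + v, s, cosh b - v)\<close>. For \<open>c = 0\<close> the first two vertices coincide
    and any point at distance \<open>a = b\<close> will do.\<close>
  define v where "v = (if c = 0 then 0 else (cosh b * cosh c - cosh a) / sinh c)"
  have v_c: "v * sinh c = cosh b * cosh c - cosh a"
    using assms by (auto simp: v_def)
  have "v\<^sup>2 \<le> (sinh b)\<^sup>2"
  proof (cases "c = 0")
    case False
    have "cosh \<bar>b - c\<bar> \<le> cosh a" "cosh a \<le> cosh (b + c)"
      using assms by (simp_all add: abs_le_iff cosh_real_nonneg_le_iff del: cosh_real_abs)
    then have "\<bar>v * sinh c\<bar> \<le> sinh b * sinh c"
      unfolding v_c cosh_real_abs by (simp add: cosh_diff cosh_add abs_le_iff)
    then have "\<bar>v\<bar> \<le> \<bar>sinh b\<bar>"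
      using False assms by (simp add: abs_mult)
    then show ?thesis by (simp only: abs_le_square_iff)
  qed (simp add: v_def)
  define s where "s = sqrt ((sinh b)\<^sup>2 - v\<^sup>2)"
  have s: "s\<^sup>2 = (cosh b)\<^sup>2 - 1 - v\<^sup>2"
    using \<open>v\<^sup>2 \<le> (sinh b)\<^sup>2\<close> by (simp add: s_def cosh_square_eq)
  have "\<bar>v\<bar> < \<bar>cosh b\<bar>"
    using \<open>v\<^sup>2 \<le> (sinh b)\<^sup>2\<close> abs_le_square_iff[of "cosh b" v] by (simp add: cosh_square_eq)
  then have "0 < cosh b - v" by simp
  moreover have "lorentz (cosh b + v, s, cosh b - v) (cosh b + v, s, cosh b - v) = 1"
    using s by (simp add: lorentz_def power2_eq_square algebra_simps)
  ultimately obtain z where z: "hcoord z = (cosh b + v, s, cosh b - v)"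
    using hcoord_surj by (metis snd_conv)
  have ee: "exp c * exp (- c) = 1" by (simp flip: exp_add)
  obtain x where x: "hcoord x = (1, 0, 1)"
    using hcoord_surj[of "(1, 0, 1)"] by (auto simp: lorentz_def)
  obtain y where y: "hcoord y = (exp c, 0, exp (- c))"
    using hcoord_surj[of "(exp c, 0, exp (- c))"] ee
    by (auto simp: lorentz_def mult.commute)
  have cc: "exp c = cosh c + sinh c" "exp (- c) = cosh c - sinh c"
    by (simp_all add: cosh_plus_sinh cosh_minus_sinh)
  have "dist x y = \<bar>c\<bar>" by (rule dist_eqI_cosh) (simp add: x y lorentz_def cc)
  moreover have "dist y z = \<bar>a\<bar>"
    by (rule dist_eqI_cosh) (use v_c in \<open>simp add: z y lorentz_def cc field_simps\<close>)
  moreover have "dist z x = \<bar>b\<bar>" by (rule dist_eqI_cosh) (simp add: x z lorentz_def)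
  ultimately show ?thesis using that assms by simp
qed

section \<open>Midpoints in a space of curvature at most minus one\<close>

text \<open>Thinness, applied to a vertex and the midpoint of the opposite side, turns the median formula of
  the hyperbolic plane into an inequality. All later uses of
  curvature go through it.\<close>
lemma CAT_minus_1_midpoint:
  fixes a b :: "'a::metric_space"
  assumes "CAT_minus_1 TYPE('a)"
  obtains m where "dist a m = dist a b / 2" "dist b m = dist a b / 2"
    "\<And>x. 2 * cosh (dist a b / 2) * cosh (dist x m) \<le> cosh (dist x a) + cosh (dist x b)"
proof -
  have geod: "\<exists>\<sigma>. geodesic_from_to \<sigma> x y" for x y :: 'a
    using assms by (simp add: CAT_minus_1_def geodesic_space_def)
  obtain \<alpha> where \<alpha>: "geodesic_from_to \<alpha> a b" using geod by blast
  let ?r = "dist a b / 2"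
  have r: "?r \<in> {0..dist a b}" "0 \<in> {0..dist a b}" "dist a b \<in> {0..dist a b}" by auto
  show ?thesis
  proof (rule that[of "\<alpha> ?r"])
    show "dist a (\<alpha> ?r) = ?r"
      using \<alpha> r unfolding geodesic_from_to_def by fastforce
    have "dist (\<alpha> (dist a b)) (\<alpha> ?r) = \<bar>dist a b - ?r\<bar>"
      using \<alpha> r unfolding geodesic_from_to_def by blast
    then show "dist b (\<alpha> ?r) = ?r"
      using \<alpha> by (simp add: geodesic_from_to_def)
    fix x
    obtain \<beta> \<gamma> where \<beta>: "geodesic_from_to \<beta> b x" and \<gamma>: "geodesic_from_to \<gamma> x a" using geod by blast
    obtain a' b' x' :: hyp_plane
      where d: "dist a' b' = dist a b" "dist b' x' = dist b x" "dist x' a' = dist x a"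
      using comparison_triangle_exists[of "dist b x" "dist x a" "dist a b"]
      by (metis dist_commute dist_triangle zero_le_dist)
    obtain \<alpha>' where \<alpha>': "geodesic_from_to \<alpha>' a' b'"
      "\<And>p. 2 * cosh (dist a' b' / 2) * cosh (dist p (\<alpha>' (dist a' b' / 2))) =
          cosh (dist p a') + cosh (dist p b')"
      using hyp_plane_geodesic by blast
    obtain \<beta>' where \<beta>': "geodesic_from_to \<beta>' b' x'" using hyp_plane_geodesic by blast
    obtain \<gamma>' where \<gamma>': "geodesic_from_to \<gamma>' x' a'" using hyp_plane_geodesic by blast
    have thin: "thin_triangles TYPE('a)" using assms by (simp add: CAT_minus_1_def)
    have "dist (\<alpha> ?r) (\<gamma> 0) \<le> dist (\<alpha>' ?r) (\<gamma>' 0)"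
      using thin[unfolded thin_triangles_def, THEN spec, of a, THEN spec, of b, THEN spec, of x,
          THEN spec, of \<alpha>, THEN spec, of \<beta>, THEN spec, of \<gamma>, THEN spec, of a', THEN spec, of b',
          THEN spec, of x', THEN spec, of \<alpha>', THEN spec, of \<beta>', THEN spec, of \<gamma>']
        \<alpha> \<beta> \<gamma> \<alpha>'(1) \<beta>' \<gamma>' d r by (simp add: geodesic_triangle_def)
    then have "dist x (\<alpha> ?r) \<le> dist x' (\<alpha>' ?r)"
      using \<gamma> \<gamma>' by (simp add: geodesic_from_to_def dist_commute)
    then have "2 * cosh ?r * cosh (dist x (\<alpha> ?r)) \<le> 2 * cosh ?r * cosh (dist x' (\<alpha>' ?r))"
      by (intro mult_left_mono) (simp_all add: cosh_real_nonneg_le_iff)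
    also have "\<dots> = cosh (dist x a) + cosh (dist x b)"
      using \<alpha>'(2)[of x'] d by (simp add: dist_commute)
    finally show "2 * cosh ?r * cosh (dist x (\<alpha> ?r)) \<le> cosh (dist x a) + cosh (dist x b)" .
  qed
qed

lemma dmax_diag_midpoint:
  fixes a b :: "'a::metric_space"
  assumes "CAT_minus_1 TYPE('a)"
  obtains m where "dist a m = dist a b / 2"
    "\<And>p. dmax p (m, m) \<le> max (dmax p (a, a)) (dmax p (b, b))"
proof -
  obtain m where m: "dist a m = dist a b / 2"
    and mid: "\<And>x. 2 * cosh (dist a b / 2) * cosh (dist x m) \<le> cosh (dist x a) + cosh (dist x b)"
    using CAT_minus_1_midpoint[OF assms] by blast
  have "dist x m \<le> max (dist x a) (dist x b)" for x
  proof -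
    let ?M = "max (dist x a) (dist x b)"
    have "2 * 1 * cosh (dist x m) \<le> 2 * cosh (dist a b / 2) * cosh (dist x m)"
      by (intro mult_right_mono mult_left_mono) (auto simp: cosh_real_ge_1 less_imp_le)
    also have "\<dots> \<le> cosh (dist x a) + cosh (dist x b)" by (rule mid)
    also have "\<dots> \<le> cosh ?M + cosh ?M"
      by (intro add_mono) (simp_all add: cosh_real_nonneg_le_iff le_max_iff_disj)
    finally have "cosh (dist x m) \<le> cosh ?M" by simp
    then show ?thesis by (simp add: cosh_real_nonneg_le_iff le_max_iff_disj)
  qed
  then have "dmax p (m, m) \<le> max (dmax p (a, a)) (dmax p (b, b))" for p
    unfolding dmax_def fst_conv snd_conv by (smt (verit))
  then show ?thesis using m that by blast
qed

text \<open>By repeatedly halving, a far point \<open>b\<close> is pulled back into the shell around \<open>a\<close>: a distance above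
  \<open>2\<close> cannot drop below \<open>1\<close> in one step, and quasi-convexity keeps the values under control.\<close>
lemma dmax_diag_annulus:
  fixes a b :: "'a::metric_space"
  assumes cat: "CAT_minus_1 TYPE('a)" and "1 \<le> dist a b"
  shows "\<exists>z. 1 \<le> dist a z \<and> dist a z \<le> 2 \<and> dmax p (z, z) \<le> max (dmax p (a, a)) (dmax p (b, b))"
proof -
  obtain n where "dist a b \<le> 2 ^ n"
    using real_arch_pow[of 2 "dist a b"] by (auto intro: less_imp_le)
  then show ?thesis using \<open>1 \<le> dist a b\<close>
  proof (induction n arbitrary: b)
    case 0
    then show ?case by (intro exI[of _ b]) simp
  next
    case (Suc n)
    show ?case
    proof (cases "dist a b \<le> 2")
      case True
      then show ?thesis using Suc.prems by (intro exI[of _ b]) simp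
    next
      case False
      obtain m where m: "dist a m = dist a b / 2"
        "dmax p (m, m) \<le> max (dmax p (a, a)) (dmax p (b, b))"
        using dmax_diag_midpoint[OF cat] by metis
      obtain z where "1 \<le> dist a z" "dist a z \<le> 2" "dmax p (z, z) \<le> max (dmax p (a, a)) (dmax p (m, m))"
        using Suc.IH[of m] Suc.prems False m(1) by auto
      then show ?thesis using m(2) by (intro exI[of _ z]) auto
    qed
  qed
qed

section \<open>Centres\<close>

text \<open>The growth rate \<open>ln (cosh t)\<close> is the limit, from above, of \<open>arcosh (cosh r cosh t) - r\<close> as \<open>r \<rightarrow> \<infinity>\<close>,
  hence the best one that holds for segments of every length \<open>2 r\<close> in the hyperbolic plane.\<close>
definition is_centre :: "('a::metric_space \<times> 'a \<Rightarrow> real) \<Rightarrow> 'a \<Rightarrow> bool" where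
  "is_centre h m \<longleftrightarrow> (\<forall>z. h (m, m) + ln (cosh (dist m z)) \<le> h (z, z))"

lemma is_centre_dmax:
  fixes p :: "'a::metric_space \<times> 'a"
  assumes "CAT_minus_1 TYPE('a)"
  obtains m where "is_centre (dmax p) m"
proof -
  obtain x y where p: "p = (x, y)" by fastforce
  define r where "r = dist x y / 2"
  obtain m where m: "dist x m = r" "dist y m = r"
    and mid: "\<And>z. 2 * cosh r * cosh (dist z m) \<le> cosh (dist z x) + cosh (dist z y)"
    using CAT_minus_1_midpoint[OF assms] unfolding r_def by metis
  have "r + ln (cosh (dist m z)) \<le> dmax p (z, z)" for z
  proof -
    define u where "u = ln (cosh (dist m z))"
    define M where "M = dmax p (z, z)"
    have u: "exp u = cosh (dist z m)" "0 \<le> u"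
      by (simp_all add: u_def cosh_real_pos cosh_real_ge_1 dist_commute)
    \<comment> \<open>It is enough that \<open>cosh (r + u) \<le> cosh r exp u\<close>, since the right-hand side is the one that
      the midpoint inequality bounds.\<close>
    have "0 \<le> r" "0 \<le> M" by (simp_all add: r_def M_def dmax_def le_max_iff_disj)
    have "cosh (r + u) = cosh r * cosh u + sinh r * sinh u" by (rule cosh_add)
    also have "\<dots> \<le> cosh r * cosh u + cosh r * sinh u"
      using u(2) by (intro add_left_mono mult_right_mono) (auto simp: sinh_le_cosh_real)
    also have "\<dots> = cosh r * cosh (dist z m)"
      by (simp add: cosh_plus_sinh u(1) flip: distrib_left)
    also have "\<dots> \<le> (cosh (dist z x) + cosh (dist z y)) / 2" using mid[of z] by simp
    also have "\<dots> \<le> (cosh M + cosh M) / 2"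
      using \<open>0 \<le> M\<close>
      by (intro divide_right_mono add_mono)
        (simp_all add: cosh_real_nonneg_le_iff M_def p dmax_def dist_commute le_max_iff_disj)
    finally have "cosh (r + u) \<le> cosh M" by simp
    then show ?thesis
      using \<open>0 \<le> r\<close> \<open>0 \<le> M\<close> u(2) by (simp add: cosh_real_nonneg_le_iff u_def M_def)
  qed
  then have "is_centre (dmax p) m" by (simp add: is_centre_def p dmax_def m)
  then show ?thesis by (rule that)
qed

lemma ln_cosh_pos: "0 < t \<Longrightarrow> 0 < ln (cosh t :: real)"
  using cosh_real_nonneg_less_iff[of 0 t] by (intro ln_gt_zero) simp

lemma is_centre_unique:
  assumes "is_centre h m" "is_centre h m'"
  shows "m = m'"
proof (rule ccontr)
  assume "m \<noteq> m'"
  then have "0 < ln (cosh (dist m m'))" by (intro ln_cosh_pos) simp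
  moreover have "h (m, m) + ln (cosh (dist m m')) \<le> h (m', m')"
    "h (m', m') + ln (cosh (dist m m')) \<le> h (m, m)"
    using assms by (simp_all add: is_centre_def) (metis dist_commute)
  ultimately show False by linarith
qed

lemma is_centre_add_const: "is_centre (\<lambda>p. h p + c) m \<longleftrightarrow> is_centre h m"
  by (simp add: is_centre_def algebra_simps)

section \<open>Open and closed sets of classes modulo constants\<close>
lemma mod_const_eq_iff:
  assumes "continuous_on UNIV f" "continuous_on UNIV g"
  shows "mod_const f = mod_const g \<longleftrightarrow> (\<exists>c. g = (\<lambda>x. f x + c))"
  using assms equiv_const_rel[THEN eq_equiv_class_iff, of f g]
  by (simp add: mod_const_def const_rel_def fun_eq_iff)

text \<open>Sets of functions closed under adding constants are saturated for \<open>mod_const\<close>; open and closed sets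
  of classes are obtained as images of open and closed saturated sets of functions.\<close>
abbreviation shift_invariant :: "('b \<Rightarrow> real) set \<Rightarrow> bool" where
  "shift_invariant S \<equiv> \<forall>f\<in>S. \<forall>c. (\<lambda>x. f x + c) \<in> S"

lemma mod_const_mem_image_iff:
  assumes "S \<subseteq> {f. continuous_on UNIV f}" "shift_invariant S" "continuous_on UNIV f"
  shows "mod_const f \<in> mod_const ` S \<longleftrightarrow> f \<in> S"
proof
  assume "mod_const f \<in> mod_const ` S"
  then obtain g where "g \<in> S" "mod_const g = mod_const f" by auto
  moreover from this obtain c where "f = (\<lambda>x. g x + c)"
    using assms mod_const_eq_iff[of g f] by auto
  ultimately show "f \<in> S" using assms(2) by simp
qed simp

lemma quotient_map_mod_const: "quotient_map compact_convergence_topology C_star mod_const"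
  unfolding C_star_def by (rule quotient_map_quotient_topology)

lemma openin_C_star_image:
  assumes "openin compact_convergence_topology S" "shift_invariant S"
  shows "openin C_star (mod_const ` S)"
proof -
  have S: "S \<subseteq> {f. continuous_on UNIV f}" using openin_subset[OF assms(1)] by simp
  then have "{f \<in> topspace compact_convergence_topology. mod_const f \<in> mod_const ` S} = S"
    using mod_const_mem_image_iff[OF S assms(2)] by auto
  then show ?thesis
    using assms(1) S by (auto simp: C_star_def openin_quotient_topology)
qed

lemma closedin_C_star_image:
  assumes "closedin compact_convergence_topology S" "shift_invariant S"
  shows "closedin C_star (mod_const ` S)"
proof -
  have S: "S \<subseteq> {f. continuous_on UNIV f}" using closedin_subset[OF assms(1)] by simp
  then have "{f \<in> topspace compact_convergence_topology. mod_const f \<in> mod_const ` S} = S"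
    using mod_const_mem_image_iff[OF S assms(2)] by auto
  moreover have "mod_const ` S \<subseteq> topspace C_star"
    using S quotient_map_mod_const by (auto simp: quotient_map_def C_star_def)
  ultimately show ?thesis
    using assms(1) quotient_map_mod_const[unfolded quotient_map_closedin, THEN conjunct2,
        THEN spec, of "mod_const ` S"] by simp
qed

lemma openin_compact_convergence_gt:
  fixes S :: "'b::topological_space set"
  assumes "compact S"
  shows "openin compact_convergence_topology {f. continuous_on UNIV f \<and> (\<forall>x\<in>S. f a < f x)}"
  unfolding openin_compact_convergence_topology
proof (intro conjI ballI)
  fix f :: "'b \<Rightarrow> real"
  assume f: "f \<in> {f. continuous_on UNIV f \<and> (\<forall>x\<in>S. f a < f x)}"
  have "\<exists>e>0. \<forall>x\<in>S. f a + 2 * e \<le> f x"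
  proof (cases "S = {}")
    case False
    obtain s where "s \<in> S" "\<forall>x\<in>S. f s \<le> f x"
      using continuous_attains_inf[OF assms False] f continuous_on_subset by blast
    then show ?thesis using f by (intro exI[of _ "(f s - f a) / 2"]) (auto simp: field_simps)
  qed (auto intro: exI[of _ 1])
  then obtain e where e: "0 < e" "\<forall>x\<in>S. f a + 2 * e \<le> f x" by blast
  have "{g. continuous_on UNIV g \<and> (\<forall>x\<in>insert a S. \<bar>g x - f x\<bar> < e)}
      \<subseteq> {f. continuous_on UNIV f \<and> (\<forall>x\<in>S. f a < f x)}"
    using e by (force simp: abs_less_iff)
  then show "\<exists>K e. compact K \<and> 0 < e \<and> {g. continuous_on UNIV g \<and> (\<forall>x\<in>K. \<bar>g x - f x\<bar> < e)}
      \<subseteq> {f. continuous_on UNIV f \<and> (\<forall>x\<in>S. f a < f x)}"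
    using compact_insert[OF assms] e(1) by blast
qed auto

text \<open>If no point of \<open>K\<close> is a centre of \<open>f\<close>, each fails against some witness \<open>z\<close> with a margin \<open>e\<close>, and
  the same witness and margin serve for nearby points. Compactness leaves finitely many
  witnesses, so a perturbation of \<open>f\<close> that is small on a compact set has no centre in \<open>K\<close> either.\<close>
lemma closedin_compact_convergence_centre:
  fixes K :: "'a::metric_space set"
  assumes "compact K"
  shows "closedin compact_convergence_topology {f. continuous_on UNIV f \<and> (\<exists>m\<in>K. is_centre f m)}"
    (is "closedin _ ?S")
  unfolding closedin_def openin_compact_convergence_topology
proof (intro conjI ballI)
  fix f :: "'a \<times> 'a \<Rightarrow> real"
  assume "f \<in> topspace compact_convergence_topology - ?S"
  then have f: "continuous_on UNIV f" and no: "\<And>m. m \<in> K \<Longrightarrow> \<not> is_centre f m" by auto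
  define U where "U = (\<lambda>(z, e). {m. f (z, z) + 2 * e < f (m, m) + ln (cosh (dist m z))})"
  have cosh0: "cosh t \<noteq> 0" for t :: real by (metis cosh_real_pos less_irrefl)
  have "open (U i)" for i
    unfolding U_def case_prod_beta
    by (intro open_Collect_less continuous_intros continuous_on_compose2[OF f])
      (auto simp: cosh0)
  moreover have "K \<subseteq> (\<Union>i\<in>UNIV \<times> {0<..}. U i)"
  proof
    fix m assume "m \<in> K"
    then obtain z where z: "f (z, z) < f (m, m) + ln (cosh (dist m z))"
      using no unfolding is_centre_def by (metis not_le)
    define e where "e = (f (m, m) + ln (cosh (dist m z)) - f (z, z)) / 4"
    have "0 < e" "m \<in> U (z, e)" using z by (simp_all add: e_def U_def field_simps)
    then show "m \<in> (\<Union>i\<in>UNIV \<times> {0<..}. U i)" by blast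
  qed
  ultimately obtain D where D: "D \<subseteq> UNIV \<times> {0<..}" "finite D" "K \<subseteq> (\<Union>i\<in>D. U i)"
    using compactE_image[OF assms, of "UNIV \<times> {0<..}" U] by blast
  define \<delta> where "\<delta> = Min (insert 1 (snd ` D))"
  have \<delta>_pos: "0 < \<delta>"
    using D(1,2) by (subst \<delta>_def, subst Min_gr_iff) auto
  have \<delta>_le: "\<delta> \<le> e" if "(z, e) \<in> D" for z e
  proof -
    have "e \<in> insert 1 (snd ` D)" using image_eqI[of e snd, OF _ that] by simp
    then show ?thesis unfolding \<delta>_def using D(2) by (intro Min_le) simp_all
  qed
  define L where "L = (\<lambda>z. (z, z)) ` (K \<union> fst ` D)"
  have "compact (K \<union> fst ` D)" using assms D(2) by (simp add: compact_Un finite_imp_compact)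
  then have "compact L"
    unfolding L_def by (intro compact_continuous_image continuous_intros)
  moreover have "{g. continuous_on UNIV g \<and> (\<forall>x\<in>L. \<bar>g x - f x\<bar> < \<delta>)}
      \<subseteq> topspace compact_convergence_topology - ?S"
  proof (intro subsetI)
    fix g assume "g \<in> {g. continuous_on UNIV g \<and> (\<forall>x\<in>L. \<bar>g x - f x\<bar> < \<delta>)}"
    then have g: "continuous_on UNIV g" "\<And>x. x \<in> L \<Longrightarrow> \<bar>g x - f x\<bar> < \<delta>" by auto
    have "\<not> is_centre g m" if mK: "m \<in> K" for m
    proof -
      obtain i where "i \<in> D" "m \<in> U i" using subsetD[OF D(3) mK] by (rule UN_E)
      then obtain z e where ze: "(z, e) \<in> D" "m \<in> U (z, e)" by (cases i) simp
      then have "(z, z) \<in> L" "(m, m) \<in> L"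
        using mK image_eqI[of z fst, OF _ ze(1)] by (simp_all add: L_def)
      then have "g (z, z) < g (m, m) + ln (cosh (dist m z))"
        using g(2)[of "(z, z)"] g(2)[of "(m, m)"] \<delta>_le[OF ze(1)] ze(2)
        unfolding U_def by (simp add: abs_less_iff)
      then show ?thesis unfolding is_centre_def by (meson not_le)
    qed
    then show "g \<in> topspace compact_convergence_topology - ?S" using g(1) by auto
  qed
  ultimately show "\<exists>K e. compact K \<and> 0 < e \<and>
      {g. continuous_on UNIV g \<and> (\<forall>x\<in>K. \<bar>g x - f x\<bar> < e)} \<subseteq> topspace compact_convergence_topology - ?S"
    using \<delta>_pos by blast
qed (simp_all add: subset_iff)

lemma shift_invariant_centred:
  "shift_invariant {f. continuous_on UNIV f \<and> (\<exists>m\<in>K. is_centre f m)}"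
  by (auto simp: is_centre_add_const intro!: continuous_on_add continuous_on_const)

definition centred_classes :: "'a::metric_space set \<Rightarrow> ('a \<times> 'a \<Rightarrow> real) set set" where
  "centred_classes K = mod_const ` {f. continuous_on UNIV f \<and> (\<exists>m\<in>K. is_centre f m)}"

lemma centred_classes_mono: "K \<subseteq> L \<Longrightarrow> centred_classes K \<subseteq> centred_classes L"
  by (auto simp: centred_classes_def)

lemma mod_const_mem_centred_classes_iff:
  "continuous_on UNIV f \<Longrightarrow> mod_const f \<in> centred_classes K \<longleftrightarrow> (\<exists>m\<in>K. is_centre f m)"
  unfolding centred_classes_def
  by (subst mod_const_mem_image_iff[OF _ shift_invariant_centred]) auto

lemma closedin_centred_classes:
  "compact K \<Longrightarrow> closedin C_star (centred_classes K)"
  unfolding centred_classes_def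
  using closedin_compact_convergence_centre shift_invariant_centred by (rule closedin_C_star_image)

lemma iota_mem_centred_classes:
  assumes "CAT_minus_1 TYPE('a::metric_space)"
  shows "iota (p :: 'a \<times> 'a) \<in> centred_classes UNIV"
proof -
  obtain m where "is_centre (dmax p) m" using is_centre_dmax[OF assms] by blast
  then show ?thesis
    by (auto simp: iota_def mod_const_mem_centred_classes_iff continuous_on_dmax)
qed

section \<open>Centres are locally bounded\<close>

text \<open>This is uniqueness of centres, read for classes.\<close>
lemma centred_classes_disjoint:
  assumes "A \<in> centred_classes K" "A \<in> centred_classes L"
  shows "K \<inter> L \<noteq> {}"
proof -
  obtain f where Af: "A = mod_const f" and "f \<in> {f. continuous_on UNIV f \<and> (\<exists>m\<in>K. is_centre f m)}"
    using assms(1) unfolding centred_classes_def by (rule imageE)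
  then obtain m where f: "continuous_on UNIV f" and m: "m \<in> K" "is_centre f m" by auto
  obtain m' where "m' \<in> L" "is_centre f m'"
    using assms(2) mod_const_mem_centred_classes_iff[OF f] unfolding Af by blast
  then show ?thesis using is_centre_unique m by blast
qed

text \<open>The neighbourhood \<open>N\<close> consists of the classes whose values on the shell around \<open>m\<close> exceed
  the value at \<open>m\<close>. A class in \<open>N\<close> coming from a point of \<open>X \<times> X\<close> has a centre, which cannot lie
  beyond the shell; since \<open>N\<close> is open and having a centre in the ball is a closed condition, the limits of such
  classes in \<open>N\<close> have a centre there too. Properness of \<open>X\<close> enters through the compactness of the ball.\<close>
lemma centre_locally_bounded:
  fixes A :: "('a::metric_space \<times> 'a \<Rightarrow> real) set"
  assumes proper: "proper_space TYPE('a)" and cat: "CAT_minus_1 TYPE('a)"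
    and A: "A \<in> centred_classes UNIV"
  obtains N m where "openin C_star N" "A \<in> N"
    "N \<inter> (C_star closure_of (range iota)) \<subseteq> centred_classes (cball m 2)"
proof -
  obtain f where Af: "A = mod_const f" and "f \<in> {f. continuous_on UNIV f \<and> (\<exists>m\<in>UNIV. is_centre f m)}"
    using A unfolding centred_classes_def by (rule imageE)
  then obtain m where f: "continuous_on UNIV f" "is_centre f m" by auto
  define S where "S = (\<lambda>z. (z, z)) ` (cball m 2 - ball m 1)"
  have "compact (cball m 2)" using proper by (simp add: proper_space_def)
  then have "compact (cball m 2 - ball m 1)" by (intro compact_diff open_ball)
  then have "compact S"
    unfolding S_def by (intro compact_continuous_image continuous_intros)
  define N where "N = mod_const ` {f. continuous_on UNIV f \<and> (\<forall>x\<in>S. f (m, m) < f x)}"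
  have sat: "shift_invariant {f. continuous_on UNIV f \<and> (\<forall>x\<in>S. f (m, m) < f x)}"
    by (auto intro!: continuous_on_add continuous_on_const)
  have "openin C_star N"
    unfolding N_def
    using openin_compact_convergence_gt[OF \<open>compact S\<close>] sat by (rule openin_C_star_image)
  moreover have "A \<in> N"
  proof -
    have "f (m, m) < f (z, z)" if "1 \<le> dist m z" for z
    proof -
      have "0 < ln (cosh (dist m z))" using that by (intro ln_cosh_pos) auto
      then show ?thesis using f(2) unfolding is_centre_def by (smt (verit))
    qed
    then have "f \<in> {f. continuous_on UNIV f \<and> (\<forall>x\<in>S. f (m, m) < f x)}"
      using f(1) by (simp add: S_def)
    then show ?thesis unfolding N_def Af by (rule imageI)
  qed
  moreover have "N \<inter> range iota \<subseteq> centred_classes (cball m 2)"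
  proof
    fix B assume "B \<in> N \<inter> range iota"
    then obtain p where p: "B = iota p" "iota p \<in> N" by auto
    have "dmax p \<in> {f. continuous_on UNIV f \<and> (\<forall>x\<in>S. f (m, m) < f x)}"
      using p(2) unfolding N_def iota_def
      by (subst (asm) mod_const_mem_image_iff[OF _ sat continuous_on_dmax]) auto
    then have gt: "dmax p (m, m) < dmax p (z, z)" if "1 \<le> dist m z" "dist m z \<le> 2" for z
      using that by (simp add: S_def)
    obtain c where c: "is_centre (dmax p) c" using is_centre_dmax[OF cat] by blast
    have "dist m c \<le> 2"
    proof (rule ccontr)
      assume "\<not> dist m c \<le> 2"
      then obtain z where z: "1 \<le> dist m z" "dist m z \<le> 2"
        "dmax p (z, z) \<le> max (dmax p (m, m)) (dmax p (c, c))"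
        using dmax_diag_annulus[OF cat, of m c p] by auto
      have "0 \<le> ln (cosh (dist c m))" by (simp add: cosh_real_ge_1)
      then have "dmax p (c, c) \<le> dmax p (m, m)"
        using c unfolding is_centre_def by (smt (verit))
      then show False using gt[OF z(1,2)] z(3) by simp
    qed
    then show "B \<in> centred_classes (cball m 2)"
      using c by (auto simp: p(1) iota_def mod_const_mem_centred_classes_iff continuous_on_dmax)
  qed
  then have "C_star closure_of (N \<inter> range iota) \<subseteq> centred_classes (cball m 2)"
    using closedin_centred_classes[OF \<open>compact (cball m 2)\<close>] by (rule closure_of_minimal)
  then have "N \<inter> (C_star closure_of (range iota)) \<subseteq> centred_classes (cball m 2)"
    using openin_Int_closure_of_subset[OF \<open>openin C_star N\<close>] by blast
  ultimately show ?thesis by (rule that)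
qed

section \<open>Compactness of the compactification\<close>

text \<open>Tychonoff's theorem gives compactness for pointwise convergence, and on an equicontinuous family
  pointwise convergence is uniform on compact sets.\<close>
lemma compactin_lipschitz_functions:
  fixes a :: "'a::metric_space \<times> 'a"
  shows "compactin compact_convergence_topology
           {f. (\<forall>p q. f p - f q \<le> dmax p q) \<and> f a = 0}"
    (is "compactin _ ?L")
proof -
  have dmax_le_dist: "dmax p q \<le> dist p q" for p q :: "'a \<times> 'a"
    by (simp add: dmax_def dist_fst_le dist_snd_le)
  have dmax_commute: "dmax p q = dmax q p" for p q :: "'a \<times> 'a"
    by (simp add: dmax_def dist_commute)
  have lip: "\<bar>f p - f q\<bar> \<le> dmax p q" if "f \<in> ?L" for f p q
  proof -
    have "\<forall>p q. f p - f q \<le> dmax p q" using that by blast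
    then have "f p - f q \<le> dmax p q" "f q - f p \<le> dmax q p" by blast+
    then show ?thesis using dmax_commute[of p q] by linarith
  qed
  have cont: "continuous_on UNIV f" if "f \<in> ?L" for f
    unfolding continuous_on_iff dist_real_def
    using lip[OF that] dmax_le_dist by (meson le_less_trans)
  have "compactin (product_topology (\<lambda>_. euclideanreal) UNIV) (\<Pi>\<^sub>E p\<in>UNIV. {- dmax p a..dmax p a})"
    by (simp add: compactin_PiE)
  then have compact_box: "compact (\<Pi>\<^sub>E p\<in>UNIV. {- dmax p a..dmax p a})"
    by (simp add: euclidean_product_topology)
  have closed_L: "closed ?L"
    by (intro closed_Collect_conj closed_Collect_all closed_Collect_le closed_Collect_eq
        continuous_intros continuous_on_product_coordinates)
  have L_sub: "?L \<subseteq> (\<Pi>\<^sub>E p\<in>UNIV. {- dmax p a..dmax p a})"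
  proof
    fix f assume f: "f \<in> ?L"
    have "f p \<in> {- dmax p a..dmax p a}" for p
      using lip[OF f, of p a] f by (simp add: abs_le_iff)
    then show "f \<in> (\<Pi>\<^sub>E p\<in>UNIV. {- dmax p a..dmax p a})" by blast
  qed
  have "compact ?L"
    using compact_Int_closed[OF compact_box closed_L] unfolding inf.absorb2[OF L_sub] .
  moreover have "continuous_map (top_of_set ?L) compact_convergence_topology (\<lambda>f. f)"
    unfolding continuous_map_def
  proof (intro conjI allI impI)
    show "(\<lambda>f. f) \<in> topspace (top_of_set ?L) \<rightarrow> topspace compact_convergence_topology"
      using cont by auto
    fix U :: "('a \<times> 'a \<Rightarrow> real) set" assume U: "openin compact_convergence_topology U"
    show "openin (top_of_set ?L) {f \<in> topspace (top_of_set ?L). f \<in> U}"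
    proof (subst openin_subopen, intro ballI)
      fix f assume "f \<in> {f \<in> topspace (top_of_set ?L). f \<in> U}"
      then have f: "f \<in> ?L" "f \<in> U" by auto
      obtain K e where K: "compact K" "0 < e"
        "{g. continuous_on UNIV g \<and> (\<forall>x\<in>K. \<bar>g x - f x\<bar> < e)} \<subseteq> U"
        using U f(2) unfolding openin_compact_convergence_topology by meson
      have "K \<subseteq> (\<Union>p\<in>K. ball p (e / 3))" using K(2) by auto
      then obtain D where D: "finite D" "K \<subseteq> (\<Union>p\<in>D. ball p (e / 3))"
        using compactE_image[OF K(1), of K "\<lambda>p. ball p (e / 3)"] open_ball by metis
      define V where "V = {g. \<forall>p\<in>D. \<bar>g p - f p\<bar> < e / 3}"
      have "V = (\<Inter>p\<in>D. {g. \<bar>g p - f p\<bar> < e / 3})" by (auto simp: V_def)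
      also have "open \<dots>"
        using D(1) by (intro open_INT ballI open_Collect_less continuous_intros continuous_on_product_coordinates)
      finally have "openin (top_of_set ?L) (?L \<inter> V)" by (rule openin_open_Int)
      moreover have "f \<in> ?L \<inter> V" using f(1) K(2) by (simp add: V_def)
      moreover have "?L \<inter> V \<subseteq> {f \<in> topspace (top_of_set ?L). f \<in> U}"
      proof
        fix g assume g: "g \<in> ?L \<inter> V"
        have "\<bar>g x - f x\<bar> < e" if x: "x \<in> K" for x
        proof -
          obtain p where p: "p \<in> D" "dist p x < e / 3" using subsetD[OF D(2) x] by auto
          then have "dmax p x < e / 3" using dmax_le_dist[of p x] by linarith
          moreover have "\<bar>g p - f p\<bar> < e / 3" using g p(1) by (simp add: V_def)
          ultimately show ?thesis
            using lip[OF f(1), of p x] lip[OF IntD1[OF g], of p x]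
            unfolding abs_less_iff abs_le_iff by linarith
        qed
        moreover have "continuous_on UNIV g" using g by (intro cont) (rule IntD1)
        ultimately have "g \<in> U" using subsetD[OF K(3)] by simp
        then show "g \<in> {f \<in> topspace (top_of_set ?L). f \<in> U}" using g by simp
      qed
      ultimately show "\<exists>T. openin (top_of_set ?L) T \<and> f \<in> T \<and> T \<subseteq> {f \<in> topspace (top_of_set ?L). f \<in> U}"
        by blast
    qed
  qed
  ultimately show ?thesis
    using image_compactin[of "top_of_set ?L" ?L compact_convergence_topology "\<lambda>f. f"]
    by simp
qed

lemma closedin_compact_convergence_lipschitz:
  "closedin compact_convergence_topology
     {f :: 'a::metric_space \<times> 'a \<Rightarrow> real. continuous_on UNIV f \<and> (\<forall>p q. f p - f q \<le> dmax p q)}"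
    (is "closedin _ ?S")
  unfolding closedin_def openin_compact_convergence_topology
proof (intro conjI ballI)
  fix f :: "'a \<times> 'a \<Rightarrow> real" assume "f \<in> topspace compact_convergence_topology - ?S"
  then have "\<not> (\<forall>p q. f p - f q \<le> dmax p q)" by (simp del: split_paired_All)
  then obtain p q where pq: "dmax p q < f p - f q" by (meson not_le)
  define e where "e = (f p - f q - dmax p q) / 2"
  have "{g. continuous_on UNIV g \<and> (\<forall>x\<in>{p, q}. \<bar>g x - f x\<bar> < e)}
      \<subseteq> topspace compact_convergence_topology - ?S"
  proof
    fix g assume "g \<in> {g. continuous_on UNIV g \<and> (\<forall>x\<in>{p, q}. \<bar>g x - f x\<bar> < e)}"
    then have g: "continuous_on UNIV g" "\<bar>g p - f p\<bar> < e" "\<bar>g q - f q\<bar> < e" by auto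
    have "2 * e = f p - f q - dmax p q" by (simp add: e_def)
    then have "dmax p q < g p - g q" using g(2,3) unfolding abs_less_iff by linarith
    then have "\<not> (\<forall>p q. g p - g q \<le> dmax p q)" by (meson not_le)
    then show "g \<in> topspace compact_convergence_topology - ?S"
      using g(1) by (simp del: split_paired_All)
  qed
  moreover have "0 < e" "compact {p, q}" using pq by (simp_all add: e_def)
  ultimately show "\<exists>K e. compact K \<and> 0 < e \<and> {g. continuous_on UNIV g \<and> (\<forall>x\<in>K. \<bar>g x - f x\<bar> < e)}
      \<subseteq> topspace compact_convergence_topology - ?S"
    by blast
qed auto

text \<open>The functions \<open>dmax p\<close> are \<open>1\<close>-Lipschitz, which is a closed condition, and every \<open>1\<close>-Lipschitz class
  has a representative vanishing at a base point.\<close>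
lemma compactin_closure_range_iota:
  "compactin C_star (C_star closure_of (range (iota :: 'a::metric_space \<times> 'a \<Rightarrow> _)))"
proof -
  fix a :: "'a \<times> 'a"
  let ?S = "{f :: 'a \<times> 'a \<Rightarrow> real. continuous_on UNIV f \<and> (\<forall>p q. f p - f q \<le> dmax p q)}"
  let ?L = "{f :: 'a \<times> 'a \<Rightarrow> real. (\<forall>p q. f p - f q \<le> dmax p q) \<and> f a = 0}"
  have "dmax r p - dmax r q \<le> dmax p q" for r p q :: "'a \<times> 'a"
    using dist_triangle[of "fst r" "fst p" "fst q"] dist_triangle[of "snd r" "snd p" "snd q"]
    by (auto simp: dmax_def dist_commute)
  then have "range iota \<subseteq> mod_const ` ?S"
    by (auto simp: iota_def continuous_on_dmax)
  moreover have "closedin C_star (mod_const ` ?S)"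
    using closedin_compact_convergence_lipschitz
    by (rule closedin_C_star_image) (auto intro!: continuous_on_add continuous_on_const)
  ultimately have "C_star closure_of (range iota) \<subseteq> mod_const ` ?S"
    by (rule closure_of_minimal)
  also have "\<dots> \<subseteq> mod_const ` ?L"
  proof (rule image_subsetI)
    fix f assume f: "f \<in> ?S"
    have "continuous_on UNIV (\<lambda>x. f x + - f a)"
      using f by (intro continuous_on_add continuous_on_const) auto
    then have "mod_const f = mod_const (\<lambda>x. f x + - f a)"
      using f mod_const_eq_iff[of f "\<lambda>x. f x + - f a"] by blast
    moreover have "(\<lambda>x. f x + - f a) \<in> ?L" using f by simp
    ultimately show "mod_const f \<in> mod_const ` ?L" by simp
  qed
  finally have "C_star closure_of (range iota) \<subseteq> mod_const ` ?L" .
  moreover have "compactin C_star (mod_const ` ?L)"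
    using compactin_lipschitz_functions quotient_imp_continuous_map[OF quotient_map_mod_const]
    by (rule image_compactin)
  ultimately show ?thesis by (meson closed_compactin closedin_closure_of)
qed

section \<open>The diagonal action\<close>
lemma continuous_on_inv_map_prod:
  assumes "g \<in> carrier isometry_group"
  shows "continuous_on UNIV (inv_into UNIV (map_prod g g))"
  unfolding isometry_map_prod(3)[OF assms] unfolding map_prod_def case_prod_beta
  by (auto intro!: continuous_intros continuous_on_compose2[OF isometry_map_prod(6)[OF assms]])

lemma continuous_map_precompose:
  assumes "continuous_on UNIV (H :: 'b::topological_space \<Rightarrow> 'b)"
  shows "continuous_map compact_convergence_topology compact_convergence_topology (\<lambda>f. f \<circ> H)"
  unfolding continuous_map_def
proof (intro conjI allI impI)
  have cont: "continuous_on UNIV (f \<circ> H)" if "continuous_on UNIV f" for f :: "'b \<Rightarrow> real"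
    using assms that by (metis continuous_on_compose continuous_on_subset top_greatest)
  then show "(\<lambda>f. f \<circ> H) \<in> topspace compact_convergence_topology \<rightarrow> topspace compact_convergence_topology"
    by auto
  fix U :: "('b \<Rightarrow> real) set" assume U: "openin compact_convergence_topology U"
  show "openin compact_convergence_topology {f \<in> topspace compact_convergence_topology. f \<circ> H \<in> U}"
    unfolding openin_compact_convergence_topology
  proof (intro conjI ballI)
    fix f assume "f \<in> {f \<in> topspace compact_convergence_topology. f \<circ> H \<in> U}"
    then have "f \<circ> H \<in> U" by simp
    then obtain K e where K: "compact K" "0 < e"
      "{g. continuous_on UNIV g \<and> (\<forall>x\<in>K. \<bar>g x - (f \<circ> H) x\<bar> < e)} \<subseteq> U"
      using U unfolding openin_compact_convergence_topology by meson
    have "compact (H ` K)"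
      using K(1) assms by (intro compact_continuous_image) (auto intro: continuous_on_subset)
    moreover have "{g. continuous_on UNIV g \<and> (\<forall>x\<in>H ` K. \<bar>g x - f x\<bar> < e)}
        \<subseteq> {f \<in> topspace compact_convergence_topology. f \<circ> H \<in> U}"
      using K(3) cont by auto
    ultimately show "\<exists>K e. compact K \<and> 0 < e \<and> {g. continuous_on UNIV g \<and> (\<forall>x\<in>K. \<bar>g x - f x\<bar> < e)}
        \<subseteq> {f \<in> topspace compact_convergence_topology. f \<circ> H \<in> U}"
      using K(2) by blast
  qed auto
qed

lemma continuous_map_diag_act:
  assumes g: "g \<in> carrier isometry_group"
  shows "continuous_map C_star C_star (diag_act g)"
proof (rule continuous_compose_quotient_map[OF quotient_map_mod_const])
  let ?H = "inv_into UNIV (map_prod g g)"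
  have "continuous_map compact_convergence_topology C_star (mod_const \<circ> (\<lambda>f. f \<circ> ?H))"
    by (intro continuous_map_compose[OF continuous_map_precompose[OF continuous_on_inv_map_prod[OF g]]]
        quotient_imp_continuous_map[OF quotient_map_mod_const])
  then show "continuous_map compact_convergence_topology C_star (diag_act g \<circ> mod_const)"
    by (rule continuous_map_eq) (simp add: diag_act_mod_const[OF g])
qed

lemma diag_act_closure:
  assumes g: "g \<in> carrier isometry_group" and "A \<in> C_star closure_of (range iota)"
  shows "diag_act g A \<in> C_star closure_of (range iota)"
proof -
  have "diag_act g ` range iota \<subseteq> range iota"
    using diag_act_iota[OF g] by auto
  then have "C_star closure_of (diag_act g ` range iota) \<subseteq> C_star closure_of (range iota)"
    by (rule closure_of_mono)
  then show ?thesis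
    using continuous_map_image_closure_subset[OF continuous_map_diag_act[OF g], of "range iota"] assms(2)
    by blast
qed

text \<open>The map from classes to centres is equivariant.\<close>
lemma diag_act_centred_classes:
  assumes g: "g \<in> carrier isometry_group" and "A \<in> centred_classes K"
  shows "diag_act g A \<in> centred_classes (g ` K)"
proof -
  obtain f where A: "A = mod_const f" and "f \<in> {f. continuous_on UNIV f \<and> (\<exists>m\<in>K. is_centre f m)}"
    using assms(2) unfolding centred_classes_def by (rule imageE)
  then obtain m where f: "continuous_on UNIV f" and m: "m \<in> K" "is_centre f m" by auto
  note iso = isometry_map_prod[OF g]
  let ?h = "f \<circ> inv_into UNIV (map_prod g g)"
  have h: "?h (z, z) = f (inv_into UNIV g z, inv_into UNIV g z)" for z
    by (simp add: iso(3))
  have "continuous_on UNIV ?h"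
    using f continuous_on_inv_map_prod[OF g]
    by (metis continuous_on_compose continuous_on_subset top_greatest)
  moreover have "is_centre ?h (g m)"
    unfolding is_centre_def h
  proof
    fix z
    show "f (inv_into UNIV g (g m), inv_into UNIV g (g m)) + ln (cosh (dist (g m) z))
        \<le> f (inv_into UNIV g z, inv_into UNIV g z)"
      using m(2)[unfolded is_centre_def, rule_format, of "inv_into UNIV g z"] iso(4)[of z m]
      by (simp add: bij_is_inj[OF iso(1)] dist_commute[of m] dist_commute[of "g m"])
  qed
  ultimately show ?thesis
    using m(1) by (auto simp: A diag_act_mod_const[OF g f] mod_const_mem_centred_classes_iff)
qed

lemma diag_act_inverse:
  assumes g: "g \<in> carrier isometry_group"
  shows "diag_act g (diag_act (inv_into UNIV g) A) = A"
proof -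
  note iso = isometry_map_prod[OF g]
  have inv: "inv_into UNIV (map_prod (inv_into UNIV g) (inv_into UNIV g)) = map_prod g g"
    using iso(2,3) by (metis inv_inv_eq)
  have "h \<circ> map_prod g g \<circ> inv_into UNIV (map_prod g g) = h" for h :: "'a \<times> 'a \<Rightarrow> real"
    using iso(2) by (simp add: fun_eq_iff bij_is_surj surj_f_inv_f)
  then show ?thesis by (simp add: diag_act_def inv image_image)
qed

section \<open>The domain of discontinuity\<close>
theorem theorem1:
  fixes \<Gamma> :: "('a::metric_space \<Rightarrow> 'a) set"
  assumes proper: "proper_space TYPE('a)"
    and noncompact: "\<not> compact (UNIV :: 'a set)"
    and cat: "CAT_minus_1 TYPE('a)"
    and group: "subgroup \<Gamma> isometry_group"
    and disc: "properly_discontinuous \<Gamma> (\<lambda>g. g) (euclidean :: 'a topology)"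
    and cocomp: "cocompact \<Gamma> (\<lambda>g. g) (euclidean :: 'a topology)"
  shows "\<exists>\<Omega> :: ('a \<times> 'a \<Rightarrow> real) set set.
           openin (subtopology max_compactification max_boundary) \<Omega> \<and>
           (\<forall>g\<in>\<Gamma>. diag_act g ` \<Omega> \<subseteq> \<Omega>) \<and>
           properly_discontinuous \<Gamma> diag_act (subtopology max_compactification (range iota \<union> \<Omega>)) \<and>
           cocompact \<Gamma> diag_act (subtopology max_compactification (range iota \<union> \<Omega>))"
proof -
  define C where "C = C_star closure_of (range (iota :: 'a \<times> 'a \<Rightarrow> _))"
  define Y where "Y = C \<inter> centred_classes (UNIV :: 'a set)"
  define \<Omega> where "\<Omega> = Y - range iota"
  have iota_top: "range iota \<subseteq> topspace (C_star :: ('a \<times> 'a \<Rightarrow> real) set topology)"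
    using continuous_on_dmax by (auto simp: iota_def C_star_def)
  then have iota_Y: "range iota \<subseteq> Y"
    using iota_mem_centred_classes[OF cat] closure_of_subset[OF iota_top]
    by (auto simp: Y_def C_def)
  then have Y_eq: "range iota \<union> \<Omega> = Y" by (auto simp: \<Omega>_def)
  have top_max: "topspace max_compactification = C"
    by (simp add: max_compactification_def C_def closure_of_subset_topspace inf.absorb2)
  have sub: "subtopology max_compactification Y = subtopology C_star Y"
    unfolding max_compactification_def subtopology_subtopology
    by (simp add: Y_def C_def Int_assoc[symmetric])
  have iso: "g \<in> carrier isometry_group" if "g \<in> \<Gamma>" for g
    using group that by (rule subgroup.mem_carrier)
  have inv: "inv_into UNIV g \<in> \<Gamma>" if "g \<in> \<Gamma>" for g
  proof -
    let ?h = "inv\<^bsub>isometry_group\<^esub> g"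
    have "?h \<in> \<Gamma>" using group that by (rule subgroup.m_inv_closed)
    moreover have "g \<circ> ?h = id"
      using group.r_inv[OF group_isometry_group iso[OF that]] by (simp add: isometry_group_def)
    then have "g (?h x) = x" for x by (simp add: fun_eq_iff)
    then have "?h = inv_into UNIV g"
      using isometry_map_prod(1)[OF iso[OF that]] by (metis bij_is_inj ext inv_f_f)
    ultimately show ?thesis by simp
  qed
  have Y_inv: "diag_act g A \<in> Y" if "g \<in> \<Gamma>" "A \<in> Y" for g A
    using that diag_act_closure[OF iso] diag_act_centred_classes[OF iso, of g A UNIV]
      centred_classes_mono[of "range g" UNIV] by (auto simp: Y_def C_def)
  have "openin max_compactification Y"
  proof (subst openin_subopen, intro ballI)
    fix A assume A: "A \<in> Y"
    then have "A \<in> centred_classes UNIV" by (simp add: Y_def)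
    then obtain N m where N: "openin C_star N" "A \<in> N" "N \<inter> C \<subseteq> centred_classes (cball m 2)"
      unfolding C_def by (rule centre_locally_bounded[OF proper cat])
    have "openin max_compactification (C \<inter> N)"
      using N(1) by (auto simp: max_compactification_def C_def openin_subtopology)
    moreover have "C \<inter> N \<subseteq> Y"
      using N(3) centred_classes_mono[of "cball m 2" UNIV] by (auto simp: Y_def)
    ultimately show "\<exists>T. openin max_compactification T \<and> A \<in> T \<and> T \<subseteq> Y"
      using A N(2) by (auto simp: Y_def)
  qed
  moreover have "\<Omega> = Y \<inter> max_boundary"
    by (auto simp: \<Omega>_def max_boundary_def top_max Y_def)
  ultimately have "openin (subtopology max_compactification max_boundary) \<Omega>"
    by (auto simp: openin_subtopology)
  moreover have "diag_act g ` \<Omega> \<subseteq> \<Omega>" if g: "g \<in> \<Gamma>" for g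
  proof (rule image_subsetI)
    fix A assume A: "A \<in> \<Omega>"
    have "diag_act g A \<notin> range iota"
    proof
      assume "diag_act g A \<in> range iota"
      then obtain x y where "diag_act g A = iota (x, y)" by auto
      moreover have "diag_act (inv_into UNIV g) (diag_act g A) = A"
        using diag_act_inverse[OF iso[OF inv[OF g]], of A] isometry_map_prod(1)[OF iso[OF g]]
        by (simp add: inv_inv_eq)
      ultimately have "A \<in> range iota"
        using diag_act_iota[OF iso[OF inv[OF g]]] by (metis rangeI)
      then show False using A by (simp add: \<Omega>_def)
    qed
    then show "diag_act g A \<in> \<Omega>" using A Y_inv[OF g] by (simp add: \<Omega>_def)
  qed
  moreover have "properly_discontinuous \<Gamma> diag_act (subtopology C_star Y)"
    unfolding properly_discontinuous_def
  proof (intro allI impI)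
    fix K assume "compactin (subtopology C_star Y) K"
    then have K: "compactin C_star K" "K \<subseteq> Y" by (simp_all add: compactin_subtopology)
    have "\<exists>N m. openin C_star N \<and> A \<in> N \<and> N \<inter> C \<subseteq> centred_classes (cball m 2)" if "A \<in> K" for A
    proof -
      have "A \<in> centred_classes UNIV" using that K(2) by (auto simp: Y_def)
      then show ?thesis unfolding C_def by (rule centre_locally_bounded[OF proper cat]) blast
    qed
    then obtain N m where N: "\<And>A. A \<in> K \<Longrightarrow> openin C_star (N A)" "\<And>A. A \<in> K \<Longrightarrow> A \<in> N A"
      "\<And>A. A \<in> K \<Longrightarrow> N A \<inter> C \<subseteq> centred_classes (cball (m A) 2)" by metis
    obtain \<F> where \<F>: "finite \<F>" "\<F> \<subseteq> N ` K" "K \<subseteq> \<Union>\<F>"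
      using compactinD[OF K(1), of "N ` K"] N(1,2) by blast
    then obtain D where D: "D \<subseteq> K" "finite D" "\<F> = N ` D" by (meson finite_subset_image)
    \<comment> \<open>A compact set that contains the centres of all classes in \<open>K\<close>.\<close>
    define B where "B = (\<Union>A\<in>D. cball (m A) 2)"
    have "compact B"
      unfolding B_def using D(2) proper by (intro compact_UN) (simp_all add: proper_space_def)
    have KB: "K \<subseteq> centred_classes B"
    proof
      fix A assume "A \<in> K"
      then obtain A' where A': "A' \<in> D" "A \<in> N A'" using \<F>(3) D(3) by auto
      then have "A \<in> centred_classes (cball (m A') 2)"
        using \<open>A \<in> K\<close> K(2) N(3)[of A'] D(1) by (auto simp: Y_def)
      then show "A \<in> centred_classes B"
        using centred_classes_mono[of "cball (m A') 2" B] A'(1) by (auto simp: B_def)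
    qed
    have "{g \<in> \<Gamma>. K \<inter> diag_act g ` K \<noteq> {}} \<subseteq> {g \<in> \<Gamma>. B \<inter> g ` B \<noteq> {}}"
    proof (intro subsetI CollectI conjI)
      fix g assume "g \<in> {g \<in> \<Gamma>. K \<inter> diag_act g ` K \<noteq> {}}"
      then obtain A where g: "g \<in> \<Gamma>" and A: "A \<in> K" "diag_act g A \<in> K" by auto
      then show "g \<in> \<Gamma>" by simp
      have "diag_act g A \<in> centred_classes B" "diag_act g A \<in> centred_classes (g ` B)"
        using A KB diag_act_centred_classes[OF iso[OF g]] by blast+
      then show "B \<inter> g ` B \<noteq> {}" using centred_classes_disjoint by blast
    qed
    moreover have "finite {g \<in> \<Gamma>. B \<inter> g ` B \<noteq> {}}"
      using disc \<open>compact B\<close> by (simp add: properly_discontinuous_def)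
    ultimately show "finite {g \<in> \<Gamma>. K \<inter> diag_act g ` K \<noteq> {}}" by (rule finite_subset)
  qed
  moreover have "cocompact \<Gamma> diag_act (subtopology C_star Y)"
  proof -
    obtain K where K: "compact K" "(UNIV :: 'a set) = (\<Union>g\<in>\<Gamma>. g ` K)"
      using cocomp by (auto simp: cocompact_def)
    let ?K = "C \<inter> centred_classes K"
    have "?K \<subseteq> Y" using centred_classes_mono[of K UNIV] by (auto simp: Y_def)
    have "closedin C_star ?K"
      unfolding C_def using K(1) by (intro closedin_Int closedin_closure_of closedin_centred_classes)
    then have "compactin C_star ?K"
      using compactin_closure_range_iota unfolding C_def by (meson closed_compactin inf_le1)
    then have "compactin (subtopology C_star Y) ?K"
      using \<open>?K \<subseteq> Y\<close> by (simp add: compactin_subtopology)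
    moreover have "Y \<subseteq> (\<Union>g\<in>\<Gamma>. diag_act g ` ?K)"
    proof
      fix A assume A: "A \<in> Y"
      then have "A \<in> centred_classes UNIV" by (simp add: Y_def)
      then obtain m where m: "A \<in> centred_classes {m}" by (auto simp: centred_classes_def)
      obtain g k where g: "g \<in> \<Gamma>" "m = g k" "k \<in> K" using K(2) by (metis UNIV_I UN_E imageE)
      let ?h = "inv_into UNIV g"
      have "?h m = k" using isometry_map_prod(1)[OF iso[OF g(1)]] by (simp add: g(2) bij_is_inj)
      then have "diag_act ?h A \<in> centred_classes K"
        using diag_act_centred_classes[OF iso[OF inv[OF g(1)]] m] g(3) centred_classes_mono[of "{k}" K]
        by auto
      moreover have "diag_act ?h A \<in> C" using Y_inv[OF inv[OF g(1)] A] by (simp add: Y_def)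
      ultimately have "diag_act g (diag_act ?h A) \<in> diag_act g ` ?K" by blast
      then show "A \<in> (\<Union>g\<in>\<Gamma>. diag_act g ` ?K)"
        using g(1) diag_act_inverse[OF iso[OF g(1)]] by auto
    qed
    moreover have "(\<Union>g\<in>\<Gamma>. diag_act g ` ?K) \<subseteq> Y"
      using Y_inv \<open>?K \<subseteq> Y\<close> by blast
    moreover have "topspace (subtopology C_star Y) = Y"
      using closure_of_subset_topspace[of C_star "range iota"] by (auto simp: Y_def C_def)
    ultimately show ?thesis unfolding cocompact_def by (metis subset_antisym)
  qed
  ultimately show ?thesis by (metis Y_eq sub)
qed

end
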